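(* Let $\{X_n:n\ge0\}$ be a Markov chain on a measurable space $(S,\mathcal{B})$ with transition probability $P$, which is reversible with respect to its (unique) invariant probability measure $\pi$, and suppose that $P(x,dy)\ge\tilde\beta\,\mathbb{1}_C(x)\,\nu(dy)$ for some set $C\in\mathcal{B}$, some $\tilde\beta>0$ and some probability measure $\nu$ on $(S,\mathcal{B})$. Let $\{u_n:n\ge0\}$ be the renewal sequence given by $u_0=1$ and $u_n=\tilde\beta\,\mathbf{P}^\nu(X_{n-1}\in C)$ for $n\ge1$, and suppose that the corresponding increment sequence $\{b_n:n\ge1\}$ (a probability distribution on the positive integers) satisfies $\sum_{n=1}^\infty b_nR^n\le L$ and $b_1\ge\beta$ for some constants $R>1$, $L<\infty$ and $\beta>0$. Assume also that $$\int Pf(x)f(x)\,\pi(dx)\ge0\qquad\text{for all }f\in L^2(\pi).$$ Then the series $\sum_{n=0}^\infty(u_n-u_\infty)z^n$ has radius of convergence at least $R$. Moreover, if $$\lim_{n\to\infty}\left|\int_CP^n\mathbb{1}_C(x)\,\pi(dx)-(\pi(C))^2\right|r^n<\infty\qquad\text{for all }0<r<R,$$ then, for $1<r<R$, $$\sum_{n=1}^\infty|u_n-u_\infty|r^n\le\frac{\sqrt{\tilde\beta}\,r}{1-r/R}.$$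
   Context: The Markov chain is time homogeneous; $P$ also denotes the operator $Pf(x)=\int f(y)P(x,dy)$. Reversible with respect to $\pi$ means $\pi(dx)P(x,dy)=\pi(dy)P(y,dx)$ as measures on $S\times S$. $\mathbf{P}^\nu$ is the law of the chain with $X_0\sim\nu$. Renewal sequences: for a probability distribution $\{b_n\}_{n\ge1}$ on the positive integers (the increment sequence; $\sum_n b_n=1$), the corresponding renewal sequence is $u_0=1$, $u_n=\sum_{k=1}^nb_ku_{n-k}$ for $n\ge1$; equivalently $u_n$ is the probability that the partial sums (including the empty sum) of i.i.d. variables with law $\{b_n\}$ hit $n$. $u_\infty=\lim_{n\to\infty}u_n$. *)

theory Defs
  imports "HOL-Probability.Probability"
begin

definition transition_op :: "('a \<Rightarrow> 'a measure) \<Rightarrow> ('a \<Rightarrow> real) \<Rightarrow> 'a \<Rightarrow> real" where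
  "transition_op P f x = (\<integral>y. f y \<partial>P x)"

definition invariant_prob :: "'a measure \<Rightarrow> ('a \<Rightarrow> 'a measure) \<Rightarrow> 'a measure \<Rightarrow> bool" where
  "invariant_prob S P \<mu> \<longleftrightarrow> \<mu> \<in> space (prob_algebra S) \<and> \<mu> \<bind> P = \<mu>"

text \<open>Equality of the measures \<open>\<mu>(dx) P(x, dy)\<close> and \<open>\<mu>(dy) P(y, dx)\<close> on the product
  space: the bound variables below are the start \<open>x\<close> and the end \<open>y\<close> of a transition.\<close>

definition reversible :: "'a measure \<Rightarrow> ('a \<Rightarrow> 'a measure) \<Rightarrow> 'a measure \<Rightarrow> bool" where
  "reversible S P \<mu> \<longleftrightarrow>
     \<mu> \<bind> (\<lambda>x. P x \<bind> (\<lambda>y. return (S \<Otimes>\<^sub>M S) (x, y))) =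
     \<mu> \<bind> (\<lambda>x. P x \<bind> (\<lambda>y. return (S \<Otimes>\<^sub>M S) (y, x)))"

text \<open>The sigma-algebra generated by \<open>X 0, \<dots>, X n\<close>, on the underlying space of \<open>\<Omega>\<close>.\<close>

definition history ::
    "'b measure \<Rightarrow> 'a measure \<Rightarrow> (nat \<Rightarrow> 'b \<Rightarrow> 'a) \<Rightarrow> nat \<Rightarrow> 'b measure" where
  "history \<Omega> S X n =
     vimage_algebra (space \<Omega>) (\<lambda>\<omega>. \<lambda>i\<in>{..n}. X i \<omega>) (\<Pi>\<^sub>M i\<in>{..n}. S)"

definition markov_chain ::
    "'b measure \<Rightarrow> 'a measure \<Rightarrow> ('a \<Rightarrow> 'a measure) \<Rightarrow> 'a measure \<Rightarrow> (nat \<Rightarrow> 'b \<Rightarrow> 'a) \<Rightarrow> bool" where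
  "markov_chain \<Omega> S P \<mu> X \<longleftrightarrow>
     prob_space \<Omega> \<and> (\<forall>n. X n \<in> \<Omega> \<rightarrow>\<^sub>M S) \<and> distr \<Omega> S (X 0) = \<mu> \<and>
     (\<forall>n. \<forall>A\<in>sets S. AE \<omega> in \<Omega>.
        real_cond_exp \<Omega> (history \<Omega> S X n) (indicator (X (Suc n) -` A \<inter> space \<Omega>)) \<omega>
          = measure (P (X n \<omega>)) A)"

text \<open>Increment sequences are indexed from 1; the value \<open>b 0\<close> plays no role.\<close>

definition increment_sequence :: "(nat \<Rightarrow> real) \<Rightarrow> bool" where
  "increment_sequence b \<longleftrightarrow> (\<forall>n\<ge>1. 0 \<le> b n) \<and> (\<lambda>n. b (Suc n)) sums 1"

definition renewal_sequence :: "(nat \<Rightarrow> real) \<Rightarrow> (nat \<Rightarrow> real) \<Rightarrow> bool" where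
  "renewal_sequence b u \<longleftrightarrow> u 0 = 1 \<and> (\<forall>n\<ge>1. u n = (\<Sum>k=1..n. b k * u (n - k)))"

end

theory Submission
  imports Defs "HOL-Complex_Analysis.Complex_Analysis"
begin

text \<open>
  Write \<open>Q f = P f - \<beta>' \<integral>f d\<nu> 1\<^sub>C\<close> for the part of the kernel that remains after the
  minorization is removed. The increments are \<open>b (k + 1) = \<beta>' \<integral>Q\<^sup>k 1\<^sub>C d\<nu>\<close>, so their finite
  mean makes \<open>\<Sum>k. \<nu> Q\<^sup>k\<close> a finite invariant measure that charges \<open>C\<close>. Uniqueness identifies it
  with a multiple of \<open>\<pi>\<close>, whence \<open>\<pi> C > 0\<close> (\<open>positive_recurrence\<close>). Invariance and the
  minorization then give \<open>\<nu> \<le> \<pi> / (\<beta>' \<pi> C)\<close>, so that \<open>\<nu>\<close> is a bounded functional on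
  \<open>L\<^sup>2(\<pi>)\<close>. Both conclusions rest on this.

  \<^emph>\<open>Radius of convergence.\<close> Let \<open>B(z) = \<Sum>k. Prob(increment > k) z\<^sup>k\<close>, so that
  \<open>(1 - z) B(z) = 1 - b(z)\<close> and \<open>1 / B\<close> is the generating function of the differences
  \<open>u n - u (n - 1)\<close>. It suffices that \<open>B\<close> has no zero in the disc of radius \<open>R\<close>, where it
  converges. At real \<open>z \<ge> 1\<close> this is clear since the coefficients are nonnegative. Everywhere else it
  follows if the renewal generating function \<open>u\<close> continues holomorphically to
  \<open>\<complex> - [1, \<infinity>)\<close>, because \<open>(1 - z) B(z) u(z) = 1\<close> persists (\<open>renewal_conv_radius\<close>). Now
  \<open>u (n + 1) = \<beta>' \<integral>P\<^sup>n 1\<^sub>C d\<nu>\<close>, and \<open>P\<close> is a positive self-adjoint contraction of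
  \<open>L\<^sup>2(\<pi>)\<close> with spectrum in \<open>[0, 1]\<close>, so the continuation is a resolvent. An elementary
  construction of it uses the conformal map \<open>z = 4 w / (1 + w)\<^sup>2\<close> of the unit disc onto
  \<open>\<complex> - [1, \<infinity>)\<close>, which turns \<open>1 / (1 - t z)\<close>, up to the factor \<open>(1 + w) / (1 - w)\<close>, into a
  power series in \<open>w\<close> whose coefficients are, apart from factors \<open>2\<close>, the
  Chebyshev polynomials \<open>T\<^sub>n(2t - 1)\<close>; the series converges in the unit disc because
  \<open>\<integral>T\<^sub>n(2P - 1) 1\<^sub>C d\<nu>\<close> is bounded in \<open>n\<close>. That bound follows from
  \<open>1 - T\<^sub>n\<^sup>2 = 4 t (1 - t) U\<^sup>2\<close>, which expresses \<open>1 - T\<^sub>n(2P - 1)\<^sup>2\<close> through squares of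
  polynomials in \<open>P\<close> multiplied by the positive operators \<open>P\<close> and \<open>1 - P\<close>.

  \<^emph>\<open>Explicit rate.\<close> Let \<open>f = 1\<^sub>C - \<pi> C\<close> and let \<open>s n = \<integral>f P\<^sup>n f d\<pi>\<close>, which is the quantity
  whose decay is assumed. By Cauchy-Schwarz \<open>(s n)\<^sup>2 \<le> s 0 s (2 n)\<close>, so decay at
  every rate below \<open>R\<close> with arbitrary constants improves to \<open>s n \<le> s 0 / R\<^sup>n\<close>
  (\<open>geometric_decay_of_doubling\<close>). Since \<open>s (2 n)\<close> is the squared norm of \<open>P\<^sup>n f\<close> and \<open>\<nu>\<close> is a
  bounded functional, \<open>\<bar>u (n + 1) - \<beta>' \<pi> C\<bar> \<le> sqrt \<beta>' / R\<^sup>n\<close> (\<open>geometric_rate\<close>). Summing a geometric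
  series gives the claim.
\<close>

section \<open>Positive moment functionals and Chebyshev polynomials\<close>

text \<open>
  When \<open>a\<close> is the moment sequence of a measure, this is integration of polynomials against that
  measure. Here \<open>a j\<close> will be a linear functional of \<open>P\<^sup>j f\<close>, for example its value at a point or its
  integral, and \<open>moment_functional a q\<close> is the same functional of \<open>q(P) f\<close>.
\<close>
definition moment_functional :: "(nat \<Rightarrow> real) \<Rightarrow> real poly \<Rightarrow> real" where
  "moment_functional a p = (\<Sum>j\<le>degree p. coeff p j * a j)"

lemma moment_functional_eq:
  assumes "degree p \<le> N"
  shows "moment_functional a p = (\<Sum>j\<le>N. coeff p j * a j)"
  unfolding moment_functional_def
  by (rule sum.mono_neutral_left) (use assms in \<open>auto simp: coeff_eq_0\<close>)

lemma moment_functional_add [simp]: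
  "moment_functional a (p + q) = moment_functional a p + moment_functional a q"
proof -
  let ?N = "max (degree p) (degree q)"
  have "moment_functional a (p + q) = (\<Sum>j\<le>?N. coeff (p + q) j * a j)"
    by (rule moment_functional_eq) (simp add: degree_add_le)
  also have "\<dots> = moment_functional a p + moment_functional a q"
    by (simp add: moment_functional_eq[of p ?N] moment_functional_eq[of q ?N] sum.distrib algebra_simps)
  finally show ?thesis .
qed

lemma moment_functional_smult [simp]: "moment_functional a (smult c p) = c * moment_functional a p"
  by (simp add: moment_functional_eq[OF degree_smult_le] moment_functional_def sum_distrib_left mult_ac)

lemma moment_functional_diff [simp]:
  "moment_functional a (p - q) = moment_functional a p - moment_functional a q"
  using moment_functional_add[of a p "smult (-1) q"] moment_functional_smult[of a "-1" q] by simp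

lemma moment_functional_0 [simp]: "moment_functional a 0 = 0"
  by (simp add: moment_functional_def)

lemma moment_functional_pCons [simp]:
  "moment_functional a (pCons c p) = c * a 0 + moment_functional (\<lambda>j. a (Suc j)) p"
  by (simp add: moment_functional_eq[OF degree_pCons_le] moment_functional_def
        sum.atMost_Suc_shift del: sum.atMost_Suc)

lemma moment_functional_1 [simp]: "moment_functional a 1 = a 0"
  by (simp add: moment_functional_def)

lemma moment_functional_monom: "moment_functional a (monom c n) = c * a n"
  by (simp add: moment_functional_eq[OF degree_monom_le] if_distrib[of "\<lambda>x. x * _"] cong: if_cong)

lemma moment_functional_mult:
  "moment_functional a (p * q) = moment_functional (\<lambda>i. moment_functional (\<lambda>j. a (i + j)) q) p"
proof (induction p arbitrary: a)
  case (pCons c p)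
  then show ?case by (simp add: mult_pCons_left)
qed simp

text \<open>
  Chebyshev polynomials transported from \<open>[-1, 1]\<close> to \<open>[0, 1]\<close>: with \<open>x = 2 t - 1\<close> these are
  \<open>T\<^sub>n(x)\<close> and \<open>U\<^sub>n\<^sub>-\<^sub>1(x)\<close>, that is \<open>cos (n \<theta>)\<close> and \<open>sin (n \<theta>) / sin \<theta>\<close> for \<open>x = cos \<theta>\<close>. The
  recursion is the addition formula, which makes the Pell identity an induction.
\<close>
fun cheb_T cheb_U :: "nat \<Rightarrow> real poly" where
  "cheb_T 0 = 1"
| "cheb_U 0 = 0"
| "cheb_T (Suc n) = [:-1, 2:] * cheb_T n - (1 - [:-1, 2:]\<^sup>2) * cheb_U n"
| "cheb_U (Suc n) = [:-1, 2:] * cheb_U n + cheb_T n"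

lemma cheb_Pell: "(cheb_T n)\<^sup>2 + (1 - [:-1, 2:]\<^sup>2) * (cheb_U n)\<^sup>2 = 1"
proof (induction n)
  case (Suc n)
  define x :: "real poly" where "x = [:-1, 2:]"
  \<comment> \<open>The identity holds for any \<open>x\<close>, so the coefficients of \<open>2 t - 1\<close> are kept folded.\<close>
  have "(x * cheb_T n - (1 - x\<^sup>2) * cheb_U n)\<^sup>2 + (1 - x\<^sup>2) * (x * cheb_U n + cheb_T n)\<^sup>2
      = (cheb_T n)\<^sup>2 + (1 - x\<^sup>2) * (cheb_U n)\<^sup>2"
    by algebra
  with Suc show ?case by (simp add: x_def)
qed simp

lemma cheb_T_rec: "cheb_T (Suc (Suc n)) = 2 * [:-1, 2:] * cheb_T (Suc n) - cheb_T n"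
proof -
  define x :: "real poly" where "x = [:-1, 2:]"
  show ?thesis
    unfolding cheb_T.simps cheb_U.simps x_def[symmetric] by algebra
qed

text \<open>
  The variable \<open>t\<close> inside \<open>2 t - 1\<close> acts on moment sequences as the shift.
\<close>
lemma moment_functional_cheb_T_rec:
  "moment_functional a (cheb_T (Suc (Suc n)))
     = 4 * moment_functional (\<lambda>j. a (Suc j)) (cheb_T (Suc n))
       - 2 * moment_functional a (cheb_T (Suc n)) - moment_functional a (cheb_T n)"
proof -
  have "cheb_T (Suc (Suc n)) = smult 4 (pCons 0 (cheb_T (Suc n))) - smult 2 (cheb_T (Suc n)) - cheb_T n"
    unfolding cheb_T_rec by (simp add: mult_pCons_left numeral_poly)
  then show ?thesis
    by (simp del: cheb_T.simps cheb_U.simps)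
qed

text \<open>
  A crude bound, good enough for absolute convergence of the expansion near \<open>w = 0\<close>; the base
  satisfies \<open>4 \<cdot> 7 + 2 \<cdot> 7 + 1 \<le> 7\<^sup>2\<close>, which is what the recurrence asks for.
\<close>
lemma abs_moment_functional_cheb_T_le:
  assumes "\<And>j. \<bar>a j\<bar> \<le> A"
  shows "\<bar>moment_functional a (cheb_T n)\<bar> \<le> A * 7 ^ n"
  using assms
proof (induction n arbitrary: a rule: less_induct)
  case (less n)
  have A: "0 \<le> A" using less.prems[of 0] by linarith
  consider "n = 0" | "n = 1" | k where "n = Suc (Suc k)"
    by (metis One_nat_def old.nat.exhaust)
  then show ?case
  proof cases
    case 1
    then show ?thesis using less.prems[of 0] by simp
  next
    case 2
    have "\<bar>2 * a 1 - a 0\<bar> \<le> 2 * \<bar>a 1\<bar> + \<bar>a 0\<bar>" by linarith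
    also have "\<dots> \<le> A * 7"
      using less.prems[of 0] less.prems[of 1] A by linarith
    finally show ?thesis using 2 by simp
  next
    case 3
    have "\<bar>moment_functional (\<lambda>j. a (Suc j)) (cheb_T (Suc k))\<bar> \<le> A * 7 ^ Suc k"
      by (rule less.IH) (use 3 less.prems in auto)
    moreover have "\<bar>moment_functional a (cheb_T (Suc k))\<bar> \<le> A * 7 ^ Suc k"
      by (rule less.IH) (use 3 less.prems in auto)
    moreover have "\<bar>moment_functional a (cheb_T k)\<bar> \<le> A * 7 ^ k"
      by (rule less.IH) (use 3 less.prems in auto)
    moreover have "0 \<le> A * 7 ^ k" using A by simp
    moreover have "A * 7 ^ Suc k = 7 * (A * 7 ^ k)" "A * 7 ^ Suc (Suc k) = 49 * (A * 7 ^ k)"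
      by simp_all
    ultimately show ?thesis
      unfolding 3 moment_functional_cheb_T_rec by linarith
  qed
qed

text \<open>
  The functional-calculus bound \<open>\<parallel>T\<^sub>n(2P - 1)\<parallel> \<le> 1\<close> in disguise. By the Pell identity
  \<open>1 - T\<^sub>n\<^sup>2 = 4 t (1 - t) U\<^sup>2\<close>, and \<open>t (1 - t) = t (1 - t)\<^sup>2 + (1 - t) t\<^sup>2\<close> splits the right side
  into terms on which \<open>m\<close> is nonnegative by hypothesis.
\<close>
lemma moment_functional_cheb_T_bound:
  assumes pos_t: "\<And>q. 0 \<le> moment_functional m ([:0, 1:] * q\<^sup>2)"
    and pos_1t: "\<And>q. 0 \<le> moment_functional m ([:1, -1:] * q\<^sup>2)"
    and dom: "\<And>q. (moment_functional a q)\<^sup>2 \<le> K * moment_functional m (q\<^sup>2)"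
    and K: "0 \<le> K"
  shows "(moment_functional a (cheb_T n))\<^sup>2 \<le> K * m 0"
proof -
  define t :: "real poly" where "t = [:0, 1:]"
  define V where "V = cheb_U n"
  have x: "[:-1, 2:] = 2 * t - 1" and t1: "[:1, -1:] = 1 - t"
    by (simp_all add: t_def numeral_poly one_pCons)
  have "1 - (cheb_T n)\<^sup>2 = (1 - (2 * t - 1)\<^sup>2) * V\<^sup>2"
    using cheb_Pell[of n] unfolding x V_def by algebra
  also have "\<dots> = smult 4 (t * ((1 - t) * V)\<^sup>2 + (1 - t) * (t * V)\<^sup>2)"
  proof -
    have smult_4: "smult 4 q = 4 * q" for q :: "real poly" by (simp add: numeral_poly)
    show ?thesis unfolding smult_4 by algebra
  qed
  finally have "moment_functional m (1 - (cheb_T n)\<^sup>2)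
      = 4 * (moment_functional m (t * ((1 - t) * V)\<^sup>2) + moment_functional m ((1 - t) * (t * V)\<^sup>2))"
    by (simp del: cheb_T.simps)
  also have "\<dots> \<ge> 0"
    using pos_t[of "(1 - t) * V"] pos_1t[of "t * V"] by (simp add: t_def t1)
  finally have "moment_functional m ((cheb_T n)\<^sup>2) \<le> m 0" by simp
  with dom[of "cheb_T n"] K show ?thesis
    by (meson mult_left_mono order_trans)
qed

text \<open>
  This is \<open>1 / (1 - t z) = (1 + w) / (1 - w) (2 \<Sum>n. T\<^sub>n(2t - 1) w\<^sup>n - 1)\<close> integrated
  against \<open>a\<close>. To avoid rearranging a double series, the right-hand sides \<open>F m\<close> for all
  shifts of \<open>a\<close> are treated at once: the three-term recurrence of \<open>T\<^sub>n\<close> becomes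
  \<open>F m = a m + z F (m + 1)\<close>, and iterating this bounded recursion produces the power series in
  \<open>z\<close>.
\<close>
lemma Chebyshev_expansion_small:
  fixes a :: "nat \<Rightarrow> real" and w z :: complex
  assumes a: "\<And>j. \<bar>a j\<bar> \<le> A" and w: "norm w < 1 / 7"
    and z: "z = 4 * w / (1 + w)\<^sup>2" "norm z < 1"
  shows "(\<lambda>n. of_real (a n) * z ^ n) sums
    ((1 + w) / (1 - w) * (2 * (\<Sum>n. of_real (moment_functional a (cheb_T n)) * w ^ n) - of_real (a 0)))"
proof -
  define d where "d m n = complex_of_real (moment_functional (\<lambda>j. a (j + m)) (cheb_T n))" for m n
  define D where "D m = (\<Sum>n. d m n * w ^ n)" for m
  \<comment> \<open>The value of the resolvent series of the \<open>m\<close>-fold shift of \<open>a\<close>, in terms of \<open>w\<close>.\<close>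
  define F where "F m = (1 + w) / (1 - w) * (2 * D m - of_real (a m))" for m
  define B where "B = A * (1 / (1 - 7 * norm w))"
  have A: "0 \<le> A" using a[of 0] by linarith
  have w1: "1 + w \<noteq> 0" "1 - w \<noteq> 0"
    using w by (auto simp: add_eq_0_iff norm_minus_commute)
  have d_bound: "norm (d m n * w ^ n) \<le> A * (7 * norm w) ^ n" for m n
  proof -
    have "\<bar>moment_functional (\<lambda>j. a (j + m)) (cheb_T n)\<bar> \<le> A * 7 ^ n"
      by (rule abs_moment_functional_cheb_T_le) (rule a)
    then have "norm (d m n) * norm w ^ n \<le> (A * 7 ^ n) * norm w ^ n"
      by (intro mult_right_mono) (simp_all add: d_def)
    then show ?thesis by (simp add: norm_mult norm_power power_mult_distrib mult_ac)
  qed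
  have geo: "(\<lambda>n. A * (7 * norm w) ^ n) sums B"
    unfolding B_def by (intro sums_mult geometric_sums) (use w in simp)
  have summ: "summable (\<lambda>n. d m n * w ^ n)" for m
    by (rule summable_comparison_test'[OF sums_summable[OF geo]]) (rule d_bound)
  have D_bound: "norm (D m) \<le> B" for m
    unfolding D_def sums_unique[OF geo]
    by (rule norm_suminf_le[OF _ sums_summable[OF geo]]) (rule d_bound)
  have rec: "F m = of_real (a m) + z * F (Suc m)" for m
  proof -
    have d0: "d m 0 = of_real (a m)" for m by (simp add: d_def)
    have d1: "d m 1 = of_real (2 * a (Suc m) - a m)" for m by (simp add: d_def)
    have dSS: "d m (Suc (Suc n)) = 4 * d (Suc m) (Suc n) - 2 * d m (Suc n) - d m n" for n
      unfolding d_def moment_functional_cheb_T_rec by simp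
    have s1: "(\<lambda>n. d m (Suc n) * w ^ Suc n) sums (D m - of_real (a m))" for m
      using sums_split_initial_segment[OF summable_sums[OF summ[of m]], of 1] by (simp add: D_def d0)
    have s2: "(\<lambda>n. d m (Suc (Suc n)) * w ^ Suc (Suc n)) sums
        (D m - (of_real (a m) + of_real (2 * a (Suc m) - a m) * w))"
      using sums_split_initial_segment[OF summable_sums[OF summ[of m]], of 2]
      by (simp add: D_def d0 d1[unfolded One_nat_def] numeral_2_eq_2)
    have "(\<lambda>n. 4 * w * (d (Suc m) (Suc n) * w ^ Suc n) - 2 * w * (d m (Suc n) * w ^ Suc n)
             - w\<^sup>2 * (d m n * w ^ n)) sums
          (4 * w * (D (Suc m) - of_real (a (Suc m))) - 2 * w * (D m - of_real (a m)) - w\<^sup>2 * D m)"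
      unfolding D_def[of m]
      by (intro sums_diff sums_mult s1[unfolded D_def] s1 summable_sums summ)
    also have "(\<lambda>n. 4 * w * (d (Suc m) (Suc n) * w ^ Suc n) - 2 * w * (d m (Suc n) * w ^ Suc n)
             - w\<^sup>2 * (d m n * w ^ n)) = (\<lambda>n. d m (Suc (Suc n)) * w ^ Suc (Suc n))"
      unfolding dSS by (simp add: fun_eq_iff algebra_simps power2_eq_square)
    finally have eq: "D m - (of_real (a m) + of_real (2 * a (Suc m) - a m) * w) =
        4 * w * (D (Suc m) - of_real (a (Suc m))) - 2 * w * (D m - of_real (a m)) - w\<^sup>2 * D m"
      using s2 sums_unique2 by blast
    have "(1 + w)\<^sup>2 * (2 * D m - of_real (a m)) =
        of_real (a m) * (1 - w) * (1 + w) + 4 * w * (2 * D (Suc m) - of_real (a (Suc m)))"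
      using eq unfolding of_real_diff of_real_mult of_real_numeral by algebra
    then have "2 * D m - of_real (a m) =
        (of_real (a m) * (1 - w) * (1 + w) + 4 * w * (2 * D (Suc m) - of_real (a (Suc m)))) / (1 + w)\<^sup>2"
      using w1 by (simp add: field_simps)
    also have "\<dots> = of_real (a m) * (1 - w) / (1 + w) + z * (2 * D (Suc m) - of_real (a (Suc m)))"
      using w1 unfolding z by (simp add: add_divide_distrib power2_eq_square)
    finally show ?thesis
      unfolding F_def using w1 by (simp add: field_simps)
  qed
  have partial: "F 0 = (\<Sum>n<N. of_real (a n) * z ^ n) + z ^ N * F N" for N
  proof (induction N)
    case (Suc N)
    then show ?case using rec[of N] by (simp add: algebra_simps)
  qed simp
  define B' where "B' = norm ((1 + w) / (1 - w)) * (2 * B + A)"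
  have F_bound: "norm (F m) \<le> B'" for m
  proof -
    have "norm (2 * D m - of_real (a m)) \<le> 2 * norm (D m) + \<bar>a m\<bar>"
      using norm_triangle_ineq4[of "2 * D m" "of_real (a m)"] by (simp add: norm_mult)
    also have "\<dots> \<le> 2 * B + A" using D_bound[of m] a[of m] by simp
    finally show ?thesis
      unfolding F_def B'_def norm_mult by (rule mult_left_mono) simp
  qed
  have "(\<lambda>N. z ^ N * F N) \<longlonglongrightarrow> 0"
  proof (rule Lim_null_comparison)
    show "\<forall>\<^sub>F N in sequentially. norm (z ^ N * F N) \<le> norm z ^ N * B'"
      by (intro always_eventually allI) (simp add: norm_mult norm_power mult_left_mono F_bound)
    show "(\<lambda>N. norm z ^ N * B') \<longlonglongrightarrow> 0"
      using tendsto_mult_left_zero[OF LIMSEQ_power_zero[of "norm z"]] z(2) by simp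
  qed
  from tendsto_diff[OF tendsto_const[of "F 0"] this]
  have "(\<lambda>N. F 0 - z ^ N * F N) \<longlonglongrightarrow> F 0" by simp
  moreover have "(\<lambda>N. F 0 - z ^ N * F N) = (\<lambda>N. \<Sum>n<N. of_real (a n) * z ^ n)"
  proof
    show "F 0 - z ^ N * F N = (\<Sum>n<N. of_real (a n) * z ^ n)" for N
      using partial[of N] by simp
  qed
  ultimately have "(\<lambda>n. of_real (a n) * z ^ n) sums F 0"
    by (simp add: sums_def)
  then show ?thesis by (simp add: F_def D_def d_def)
qed

text \<open>
  The plane without the ray \<open>[1, \<infinity>)\<close>, written as the domain on which the principal branch of
  the square root of \<open>1 - z\<close> is holomorphic.
\<close>
definition slit_plane :: "complex set" where
  "slit_plane = {z. 1 - z \<notin> \<real>\<^sub>\<le>\<^sub>0}"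

lemma open_slit_plane: "open slit_plane"
proof -
  have "slit_plane = (\<lambda>z. 1 - z) -` (- \<real>\<^sub>\<le>\<^sub>0)"
    by (auto simp: slit_plane_def)
  moreover have "open \<dots>"
    by (intro open_vimage open_Compl closed_nonpos_Reals_complex continuous_intros)
  ultimately show ?thesis by simp
qed

text \<open>
  With \<open>s\<close> the square root of \<open>1 - z\<close>, the inverse of \<open>w \<mapsto> 4 w / (1 + w)\<^sup>2\<close> is
  \<open>w = (1 - s) / (1 + s)\<close>. It lands in the unit disc because \<open>Re s > 0\<close>.
\<close>
lemma slit_plane_Koebe:
  assumes "z \<in> slit_plane"
  defines "s \<equiv> csqrt (1 - z)"
  shows "s \<noteq> 0" "1 + s \<noteq> 0" "norm ((1 - s) / (1 + s)) < 1"
    and "z = 4 * ((1 - s) / (1 + s)) / (1 + (1 - s) / (1 + s))\<^sup>2"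
    and "(1 + (1 - s) / (1 + s)) / (1 - (1 - s) / (1 + s)) = 1 / s"
proof -
  have s2: "s\<^sup>2 = 1 - z" by (simp add: s_def)
  have "Re s \<noteq> 0"
  proof
    assume "Re s = 0"
    then have "1 - z \<in> \<real>\<^sub>\<le>\<^sub>0"
      unfolding s2[symmetric] by (simp add: complex_nonpos_Reals_iff power2_eq_square)
    with assms show False by (simp add: slit_plane_def)
  qed
  moreover have "0 \<le> Re s"
    using csqrt_principal[of "1 - z"] by (auto simp: s_def)
  ultimately have "0 < Re s" by simp
  then show s0: "s \<noteq> 0" and s1: "1 + s \<noteq> 0"
    by (auto simp: complex_eq_iff)
  have "(norm (1 - s))\<^sup>2 < (norm (1 + s))\<^sup>2"
    using \<open>0 < Re s\<close> unfolding cmod_power2 by (simp add: power2_eq_square algebra_simps)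
  then have "norm (1 - s) < norm (1 + s)"
    by (rule power2_less_imp_less) simp
  then show "norm ((1 - s) / (1 + s)) < 1"
    using s1 by (simp add: norm_divide divide_simps)
  from s2 have z: "z = (1 - s) * (1 + s)" by (simp add: algebra_simps power2_eq_square)
  have p: "1 + (1 - s) / (1 + s) = 2 / (1 + s)" and m: "1 - (1 - s) / (1 + s) = 2 / (1 + s) * s"
    using s1 by (simp_all add: field_simps)
  show "z = 4 * ((1 - s) / (1 + s)) / (1 + (1 - s) / (1 + s))\<^sup>2"
    unfolding p by (rule trans[OF z]) (use s1 in \<open>simp add: power_divide power2_eq_square del: csqrt.simps\<close>)
  show "(1 + (1 - s) / (1 + s)) / (1 - (1 - s) / (1 + s)) = 1 / s"
    unfolding p m using nonzero_divide_mult_cancel_left[of "2 / (1 + s)" s] s1 by simp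
qed

text \<open>
  Bounded Chebyshev coefficients make the series in \<open>w\<close> converge in the whole unit disc, and
  composing it with the inverse conformal map yields the continuation in \<open>z\<close>.
\<close>
lemma holomorphic_extension_slit_plane:
  fixes a :: "nat \<Rightarrow> real"
  assumes a: "\<And>j. \<bar>a j\<bar> \<le> A"
    and cheb: "\<And>n. \<bar>moment_functional a (cheb_T n)\<bar> \<le> B"
  obtains G where "G holomorphic_on slit_plane"
    and "\<forall>\<^sub>F z in nhds 0. (\<lambda>n. of_real (a n) * z ^ n) sums G z"
proof -
  define f where "f = Abs_fps (\<lambda>n. complex_of_real (moment_functional a (cheb_T n)))"
  define w where "w z = (1 - csqrt (1 - z)) / (1 + csqrt (1 - z))" for z
  define G where "G z = 1 / csqrt (1 - z) * (2 * eval_fps f (w z) - of_real (a 0))" for z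
  have "1 \<le> fps_conv_radius f"
    unfolding fps_conv_radius_def
  proof (rule conv_radius_geI_ex')
    fix r :: real assume r: "0 < r" "ereal r < 1"
    show "summable (\<lambda>n. fps_nth f n * of_real r ^ n)"
    proof (rule summable_comparison_test')
      show "summable (\<lambda>n. B * r ^ n)"
        by (intro summable_mult summable_geometric) (use r in simp)
      show "norm (fps_nth f n * of_real r ^ n) \<le> B * r ^ n" for n
        using mult_right_mono[OF cheb[of n], of "r ^ n"] r by (simp add: f_def norm_mult norm_power)
    qed
  qed
  then have f_hol: "eval_fps f holomorphic_on ball 0 1"
    by (intro holomorphic_on_eval_fps subsetI)
       (auto simp: in_eball_iff intro!: less_le_trans[of _ 1 "fps_conv_radius f"])
  have slit: "1 - z \<notin> \<real>\<^sub>\<le>\<^sub>0" if "z \<in> slit_plane" for z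
    using that by (simp add: slit_plane_def)
  have w_hol: "w holomorphic_on slit_plane"
    unfolding w_def using slit_plane_Koebe(2) slit by (intro holomorphic_intros) auto
  have "(eval_fps f \<circ> w) holomorphic_on slit_plane"
    using w_hol f_hol by (rule holomorphic_on_compose_gen) (use slit_plane_Koebe(3) in \<open>auto simp: w_def\<close>)
  then have "G holomorphic_on slit_plane"
    unfolding G_def o_def using slit_plane_Koebe(1) slit by (intro holomorphic_intros) auto
  moreover have "\<forall>\<^sub>F z in nhds 0. (\<lambda>n. of_real (a n) * z ^ n) sums G z"
  proof -
    have "(0::complex) \<in> slit_plane" by (simp add: slit_plane_def complex_nonpos_Reals_iff)
    then have ev_slit: "\<forall>\<^sub>F z in nhds 0. z \<in> slit_plane"
      using open_slit_plane by (rule eventually_nhds_in_open[rotated])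
    have "isCont w 0"
      using holomorphic_on_imp_continuous_on[OF w_hol] \<open>0 \<in> slit_plane\<close> open_slit_plane
      by (simp add: continuous_on_eq_continuous_at)
    have "w 0 = 0" by (simp add: w_def)
    with \<open>isCont w 0\<close> have "(w \<longlongrightarrow> 0) (nhds 0)"
      using tendsto_at_iff_tendsto_nhds[of w 0] by (simp add: isCont_def)
    then have "\<forall>\<^sub>F z in nhds 0. norm (w z) < 1 / 7"
      using order_tendstoD(2)[OF tendsto_norm, of w 0 "nhds 0" "1 / 7"] by simp
    moreover have "\<forall>\<^sub>F z in nhds (0::complex). norm z < 1"
      using eventually_nhds_in_open[of "ball 0 1" "0::complex"] by simp
    ultimately show ?thesis
      using ev_slit
    proof eventually_elim
      case (elim z)
      note K = slit_plane_Koebe[OF elim(3), folded w_def]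
      show ?case
        using Chebyshev_expansion_small[OF a elim(1) K(4) elim(2)]
        unfolding K(5) G_def eval_fps_def f_def by simp
    qed
  qed
  ultimately show thesis by (rule that)
qed

section \<open>Renewal sequences with an analytically continued generating function\<close>

text \<open>
  The probability that an increment exceeds \<open>k\<close>. These are the coefficients of
  \<open>(1 - b(z)) / (1 - z)\<close>, the factor left when the zero of \<open>1 - b(z)\<close> at \<open>1\<close> is removed.
\<close>
definition increment_tail :: "(nat \<Rightarrow> real) \<Rightarrow> nat \<Rightarrow> real" where
  "increment_tail b k = 1 - (\<Sum>j=1..k. b j)"

lemma increment_tail_0 [simp]: "increment_tail b 0 = 1"
  by (simp add: increment_tail_def)

lemma increment_tail_Suc: "increment_tail b (Suc k) = increment_tail b k - b (Suc k)"
  by (simp add: increment_tail_def)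

lemma increment_tail_nonneg:
  assumes "increment_sequence b"
  shows "0 \<le> increment_tail b k"
proof -
  have "(\<Sum>j=1..k. b j) = (\<Sum>j<k. b (Suc j))"
    by (simp add: sum.atLeast1_atMost_eq)
  also have "\<dots> \<le> (\<Sum>j. b (Suc j))"
    by (rule sum_le_suminf) (use assms in \<open>auto simp: increment_sequence_def sums_iff\<close>)
  also have "\<dots> = 1" using assms by (simp add: increment_sequence_def sums_iff)
  finally show ?thesis by (simp add: increment_tail_def)
qed

text \<open>
  Markov's inequality for \<open>R\<close> raised to the increment.
\<close>
lemma increment_tail_bound:
  assumes b: "increment_sequence b" and R: "1 \<le> R"
    and summ: "summable (\<lambda>n. b (Suc n) * R ^ Suc n)"
  shows "increment_tail b k * R ^ k \<le> (\<Sum>n. b (Suc n) * R ^ Suc n)"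
proof -
  have "(\<lambda>j. b (Suc (j + k))) sums (1 - (\<Sum>j<k. b (Suc j)))"
    using b sums_split_initial_segment[of "\<lambda>n. b (Suc n)" 1 k] by (simp add: increment_sequence_def)
  moreover have "(\<Sum>j<k. b (Suc j)) = (\<Sum>j=1..k. b j)"
    by (simp add: sum.atLeast1_atMost_eq)
  ultimately have t: "(\<lambda>j. b (Suc (j + k))) sums increment_tail b k"
    by (simp add: increment_tail_def)
  have nn: "0 \<le> b (Suc n)" for n using b by (simp add: increment_sequence_def)
  have summ': "summable (\<lambda>j. b (Suc (j + k)) * R ^ Suc (j + k))"
    using summable_ignore_initial_segment[OF summ, of k] by simp
  have "increment_tail b k * R ^ k = (\<Sum>j. b (Suc (j + k)) * R ^ k)"
    using sums_mult2[OF t, of "R ^ k"] by (simp add: sums_iff)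
  also have "\<dots> \<le> (\<Sum>j. b (Suc (j + k)) * R ^ Suc (j + k))"
  proof (rule suminf_le)
    show "b (Suc (j + k)) * R ^ k \<le> b (Suc (j + k)) * R ^ Suc (j + k)" for j
      by (intro mult_left_mono power_increasing) (use nn R in auto)
    show "summable (\<lambda>j. b (Suc (j + k)) * R ^ k)"
      using t by (intro summable_mult2) (simp add: sums_iff)
  qed (rule summ')
  also have "\<dots> \<le> (\<Sum>n. b (Suc n) * R ^ Suc n)"
    using suminf_split_initial_segment[OF summ, of k] R nn
    by (simp add: sum_nonneg)
  finally show ?thesis .
qed

lemma increment_tail_summable:
  assumes b: "increment_sequence b" and R: "1 < R"
    and summ: "summable (\<lambda>n. b (Suc n) * R ^ Suc n)"
  shows "summable (increment_tail b)"
proof (rule summable_comparison_test')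
  let ?L = "\<Sum>n. b (Suc n) * R ^ Suc n"
  show "summable (\<lambda>k. ?L * (1 / R) ^ k)"
    using R by (intro summable_mult summable_geometric) simp
  show "norm (increment_tail b k) \<le> ?L * (1 / R) ^ k" for k
  proof -
    have "increment_tail b k * R ^ k \<le> ?L"
      using increment_tail_bound[OF b _ summ] R by simp
    then show ?thesis
      using increment_tail_nonneg[OF b] R by (simp add: power_divide pos_le_divide_eq)
  qed
qed

text \<open>
  The renewal equation determines its increments recursively because \<open>u 0 = 1\<close>.
\<close>
lemma renewal_increments_unique:
  assumes ren: "renewal_sequence b u"
    and c: "\<And>n. u (Suc n) = (\<Sum>j\<le>n. c j * u (n - j))"
  shows "c n = b (Suc n)"
proof (induction n rule: less_induct)
  case (less n)
  have u0: "u 0 = 1" using ren by (simp add: renewal_sequence_def)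
  have "u (Suc n) = (\<Sum>k=1..Suc n. b k * u (Suc n - k))"
    using ren unfolding renewal_sequence_def by simp
  also have "\<dots> = (\<Sum>j\<le>n. b (Suc j) * u (n - j))"
    unfolding One_nat_def sum.shift_bounds_cl_Suc_ivl by (simp add: atLeast0AtMost)
  finally have "(\<Sum>j\<le>n. c j * u (n - j)) = (\<Sum>j\<le>n. b (Suc j) * u (n - j))"
    using c[of n] by simp
  moreover have "(\<Sum>j<n. c j * u (n - j)) = (\<Sum>j<n. b (Suc j) * u (n - j))"
    using less by simp
  ultimately show ?case
    using u0 by (simp add: lessThan_Suc_atMost[symmetric])
qed

lemma conv_radius_geI_bound:
  fixes f :: "nat \<Rightarrow> complex"
  assumes R: "0 < R" and bound: "\<And>n. norm (f n) * R ^ n \<le> K"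
  shows "ereal R \<le> conv_radius f"
proof (rule conv_radius_geI_ex')
  fix r :: real assume r: "0 < r" "ereal r < ereal R"
  show "summable (\<lambda>n. f n * of_real r ^ n)"
  proof (rule summable_comparison_test')
    show "summable (\<lambda>n. K * (r / R) ^ n)"
      using r by (intro summable_mult summable_geometric) simp
    show "norm (f n * of_real r ^ n) \<le> K * (r / R) ^ n" for n
    proof -
      have "norm (f n) * r ^ n = (norm (f n) * R ^ n) * (r / R) ^ n"
        using R by (simp add: power_divide)
      also have "\<dots> \<le> K * (r / R) ^ n"
        by (rule mult_right_mono[OF bound]) (use r R in simp)
      finally show ?thesis using r by (simp add: norm_mult norm_power)
    qed
  qed
qed

text \<open>
  Beyond radius \<open>1\<close> the differences are summable, so \<open>u\<close> converges and \<open>lim u - u n\<close> is a tail of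
  their series, which decays at the same geometric rates. Convergence of \<open>u\<close> thus comes out of the
  argument, which gives the value \<open>lim u\<close> its meaning.
\<close>
lemma conv_radius_from_differences:
  fixes u :: "nat \<Rightarrow> real"
  assumes R: "1 < R"
    and diff: "ereal R \<le> conv_radius (\<lambda>n. complex_of_real (u (Suc n) - u n))"
  shows "ereal R \<le> conv_radius (\<lambda>n. complex_of_real (u n - lim u))"
proof -
  define d where "d n = u (Suc n) - u n" for n
  have bound: "\<exists>K. \<forall>n. \<bar>u n - lim u\<bar> * r ^ n \<le> K" if r: "1 < r" "r < R" for r
  proof -
    have summ: "summable (\<lambda>n. \<bar>d n\<bar> * r ^ n)"
      using abs_summable_in_conv_radius[of "complex_of_real r" "\<lambda>n. complex_of_real (d n)"]
        less_le_trans[OF _ diff, of "ereal r"] r by (simp add: norm_mult norm_power d_def flip: of_real_diff)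
    have summ_d: "summable (\<lambda>n. \<bar>d n\<bar>)"
    proof (rule summable_comparison_test'[OF summ])
      show "norm \<bar>d n\<bar> \<le> \<bar>d n\<bar> * r ^ n" for n
        using mult_left_mono[of 1 "r ^ n" "\<bar>d n\<bar>"] r by simp
    qed
    have tel: "(\<Sum>k<n. d k) = u n - u 0" for n
      by (simp add: d_def sum_lessThan_telescope)
    have conv: "convergent u"
    proof -
      have "convergent (\<lambda>n. u n - u 0)"
        using summable_rabs_cancel[OF summ_d] unfolding summable_iff_convergent tel .
      from convergent_add[OF this convergent_const[of "u 0"]] show ?thesis by simp
    qed
    have "\<bar>u n - lim u\<bar> * r ^ n \<le> (\<Sum>n. \<bar>d n\<bar> * r ^ n)" for n
    proof -
      have "(\<lambda>k. d (k + n)) sums (lim u - u n)"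
      proof -
        have "(\<lambda>m. \<Sum>k<m. d (k + n)) = (\<lambda>m. u (m + n) - u n)"
        proof
          show "(\<Sum>k<m. d (k + n)) = u (m + n) - u n" for m
            using sum_lessThan_telescope[of "\<lambda>k. u (k + n)" m] by (simp add: d_def)
        qed
        moreover have "(\<lambda>m. u (m + n) - u n) \<longlonglongrightarrow> lim u - u n"
          using LIMSEQ_ignore_initial_segment[of u "lim u" n] conv
          by (intro tendsto_diff tendsto_const) (simp add: convergent_LIMSEQ_iff)
        ultimately show ?thesis by (simp add: sums_def)
      qed
      then have "lim u - u n = (\<Sum>k. d (k + n))" by (simp add: sums_iff)
      also have "\<bar>\<dots>\<bar> \<le> (\<Sum>k. \<bar>d (k + n)\<bar>)"
        by (rule summable_rabs) (rule summable_ignore_initial_segment[OF summ_d])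
      finally have "\<bar>u n - lim u\<bar> * r ^ n \<le> (\<Sum>k. \<bar>d (k + n)\<bar>) * r ^ n"
        using r by (simp add: abs_minus_commute)
      also have "\<dots> = (\<Sum>k. \<bar>d (k + n)\<bar> * r ^ n)"
        by (rule suminf_mult2) (rule summable_ignore_initial_segment[OF summ_d])
      also have "\<dots> \<le> (\<Sum>k. \<bar>d (k + n)\<bar> * r ^ (k + n))"
      proof (rule suminf_le)
        show "\<bar>d (k + n)\<bar> * r ^ n \<le> \<bar>d (k + n)\<bar> * r ^ (k + n)" for k
          by (intro mult_left_mono power_increasing) (use r in auto)
        show "summable (\<lambda>k. \<bar>d (k + n)\<bar> * r ^ n)"
          by (intro summable_mult2 summable_ignore_initial_segment[OF summ_d])
      qed (rule summable_ignore_initial_segment[OF summ])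
      also have "\<dots> \<le> (\<Sum>k. \<bar>d k\<bar> * r ^ k)"
        using suminf_split_initial_segment[OF summ, of n] r by (simp add: sum_nonneg)
      finally show ?thesis .
    qed
    then show ?thesis by blast
  qed
  show ?thesis
  proof (rule dense_le)
    fix e assume e: "e < ereal R"
    obtain r where r: "1 < r" "r < R" "e \<le> ereal r"
    proof -
      obtain r' where r': "max e 1 < ereal r'" "ereal r' < ereal R"
        using ereal_dense2[of "max e 1" "ereal R"] e R by auto
      then show thesis by (intro that[of r']) (auto simp: one_ereal_def)
    qed
    from bound[OF r(1,2)] obtain K where "\<And>n. \<bar>u n - lim u\<bar> * r ^ n \<le> K" by blast
    then have "ereal r \<le> conv_radius (\<lambda>n. complex_of_real (u n - lim u))"
      using r by (intro conv_radius_geI_bound[of _ _ K]) (auto simp flip: of_real_diff)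
    with r(3) show "e \<le> conv_radius (\<lambda>n. complex_of_real (u n - lim u))" by (rule order_trans)
  qed
qed

text \<open>
  With \<open>T(z)\<close> the generating function of the tails, \<open>1 / T\<close> generates the differences of \<open>u\<close>, so
  only zeros of \<open>T\<close> inside the disc of radius \<open>R\<close> could reduce the radius of convergence. On
  \<open>[1, R)\<close> the series \<open>T\<close> has nonnegative terms and starts with \<open>1\<close>. On the rest of the disc,
  which is star-shaped about \<open>0\<close>, the identity \<open>(1 - z) T(z) G(z) = 1\<close> extends from a
  neighbourhood of \<open>0\<close> by analytic continuation.
\<close>
lemma renewal_conv_radius:
  fixes b u :: "nat \<Rightarrow> real"
  assumes b: "increment_sequence b" and ren: "renewal_sequence b u"
    and R: "1 < R" and summ: "summable (\<lambda>n. b (Suc n) * R ^ Suc n)"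
    and ext: "G holomorphic_on slit_plane"
    and G: "\<forall>\<^sub>F z in nhds 0. (\<lambda>n. of_real (u n) * z ^ n) sums G z"
  shows "ereal R \<le> conv_radius (\<lambda>n. complex_of_real (u n - lim u))"
proof -
  define T where "T = Abs_fps (\<lambda>k. complex_of_real (increment_tail b k))"
  define U where "U = Abs_fps (\<lambda>n. complex_of_real (u n))"
  have T_radius: "ereal R \<le> fps_conv_radius T"
    unfolding fps_conv_radius_def
  proof (rule conv_radius_geI_bound)
    show "norm (fps_nth T k) * R ^ k \<le> (\<Sum>n. b (Suc n) * R ^ Suc n)" for k
      using increment_tail_nonneg[OF b, of k] increment_tail_bound[OF b _ summ, of k] R
      by (simp add: T_def)
  qed (use R in simp)

  define c where "c = Abs_fps (\<lambda>n. if n = 0 then 0 else complex_of_real (b n))"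
  have "(1 - fps_X) * T = 1 - c"
  proof (rule fps_ext)
    show "fps_nth ((1 - fps_X) * T) n = fps_nth (1 - c) n" for n
      by (cases n) (simp_all add: left_diff_distrib T_def c_def increment_tail_Suc)
  qed
  moreover have "(1 - c) * U = 1"
  proof (rule fps_ext)
    show "fps_nth ((1 - c) * U) n = fps_nth 1 n" for n
    proof (cases "n = 0")
      case True
      then show ?thesis using ren by (simp add: renewal_sequence_def U_def c_def)
    next
      case False
      have "fps_nth (c * U) n = (\<Sum>k=1..n. of_real (b k) * of_real (u (n - k)))"
        unfolding fps_mult_nth
        by (rule sum.mono_neutral_cong_right) (auto simp: c_def U_def)
      also have "\<dots> = of_real (u n)"
        using ren False unfolding renewal_sequence_def by simp
      finally show ?thesis using False by (simp add: left_diff_distrib U_def)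
    qed
  qed
  ultimately have TU: "(1 - fps_X) * T * U = 1" by simp
  have T_0: "fps_nth T 0 = 1" by (simp add: T_def)
  have X1_radius: "fps_conv_radius (1 - fps_X :: complex fps) = \<infinity>"
    using fps_conv_radius_diff[of "1 :: complex fps" fps_X] by simp
  have T1_radius: "ereal R \<le> fps_conv_radius ((1 - fps_X) * T)"
    using fps_conv_radius_mult[of "1 - fps_X" T] T_radius X1_radius by simp
  have U_radius: "0 < fps_conv_radius U"
  proof -
    have "U = inverse ((1 - fps_X) * T)"
      using fps_inverse_unique[OF TU] by simp
    moreover have "0 < fps_conv_radius ((1 - fps_X) * T)"
      using T1_radius R by (intro less_le_trans[OF _ T1_radius]) simp
    ultimately show ?thesis
      using fps_conv_radius_inverse_pos[of "(1 - fps_X) * T"] T_0 by simp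
  qed
  have eval_T1: "eval_fps ((1 - fps_X) * T) z = (1 - z) * eval_fps T z" if "norm z < R" for z
  proof -
    have "ereal (norm z) < fps_conv_radius T"
      by (rule less_le_trans[OF _ T_radius]) (use that in simp)
    moreover have "eval_fps (1 - fps_X) z = 1 - z"
      using eval_fps_diff[of z 1 fps_X] by simp
    ultimately show ?thesis
      using eval_fps_mult[of z "1 - fps_X" T] X1_radius by simp
  qed
  define D where "D = ball 0 R \<inter> slit_plane"
  have "open D" unfolding D_def using open_slit_plane by blast
  have "0 \<in> slit_plane" by (simp add: slit_plane_def complex_nonpos_Reals_iff)
  then have "0 \<in> D" using R by (simp add: D_def)
  have T_hol: "eval_fps T holomorphic_on D"
    by (intro holomorphic_on_eval_fps subsetI)
       (auto simp: D_def in_eball_iff intro!: less_le_trans[OF _ T_radius])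
  have identity: "(1 - z) * eval_fps T z * G z = 1" if "z \<in> D" for z
  proof -
    have "\<forall>\<^sub>F z in nhds 0. z \<in> D \<and> z \<in> eball 0 (fps_conv_radius U) \<and>
        (\<lambda>n. of_real (u n) * z ^ n) sums G z"
      by (intro eventually_conj G eventually_nhds_in_open)
         (use \<open>open D\<close> \<open>0 \<in> D\<close> U_radius in \<open>simp_all add: in_eball_iff zero_ereal_def\<close>)
    then obtain N where N: "open N" "0 \<in> N"
      and "\<And>z. z \<in> N \<Longrightarrow> z \<in> D \<and> z \<in> eball 0 (fps_conv_radius U) \<and>
        (\<lambda>n. of_real (u n) * z ^ n) sums G z"
      unfolding eventually_nhds by blast
    then have ND: "N \<subseteq> D" and N_U: "\<And>z. z \<in> N \<Longrightarrow> ereal (norm z) < fps_conv_radius U"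
      and N_G: "\<And>z. z \<in> N \<Longrightarrow> (\<lambda>n. of_real (u n) * z ^ n) sums G z"
      by (auto simp: in_eball_iff)
    show ?thesis
    proof (rule analytic_continuation_open[where f = "\<lambda>z. (1 - z) * eval_fps T z * G z" and g = "\<lambda>_. 1"])
      show "connected D"
      proof (rule starlike_imp_connected)
        have "closed_segment 0 z \<subseteq> D" if z: "z \<in> D" for z
        proof
          fix y assume "y \<in> closed_segment 0 z"
          then obtain t where t: "0 \<le> t" "t \<le> 1" "y = of_real t * z"
            by (auto simp: in_segment scaleR_conv_of_real)
          have "norm y \<le> norm z"
            using t mult_right_mono[of t 1 "norm z"] by (simp add: norm_mult)
          moreover have "y \<in> slit_plane"
          proof (rule ccontr)
            assume "y \<notin> slit_plane"
            then have y: "1 \<le> t * Re z" "t * Im z = 0"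
              by (auto simp: slit_plane_def complex_nonpos_Reals_iff t)
            then have "Im z = 0" by auto
            moreover have "1 \<le> Re z"
              using y(1) t by (smt (verit) mult_left_le_one_le mult_nonneg_nonpos)
            ultimately show False
              using z by (simp add: D_def slit_plane_def complex_nonpos_Reals_iff)
          qed
          ultimately show "y \<in> D" using z by (simp add: D_def)
        qed
        then show "starlike D" using \<open>0 \<in> D\<close> by (auto simp: starlike_def)
      qed
      show "(\<lambda>z. (1 - z) * eval_fps T z * G z) holomorphic_on D"
        by (intro holomorphic_intros T_hol holomorphic_on_subset[OF ext]) (simp add: D_def)
      fix z assume z: "z \<in> N"
      then have zR: "norm z < R" using ND by (auto simp: D_def)
      have "eval_fps U z = G z"
        using N_G[OF z] by (simp add: eval_fps_def U_def sums_iff)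
      moreover have "eval_fps ((1 - fps_X) * T * U) z = eval_fps ((1 - fps_X) * T) z * eval_fps U z"
        by (rule eval_fps_mult[OF less_le_trans[OF _ T1_radius] N_U[OF z]]) (use zR in simp)
      ultimately show "(1 - z) * eval_fps T z * G z = 1"
        using eval_T1[OF zR] TU by simp
    qed (use N ND \<open>open D\<close> that in auto)
  qed
  have T_nonzero: "eval_fps T z \<noteq> 0" if z: "ereal (norm z) < ereal R" for z
  proof (cases "z \<in> slit_plane")
    case True
    then show ?thesis using identity[of z] z by (auto simp: D_def)
  next
    case False
    then have "Im z = 0" "1 \<le> Re z" by (auto simp: slit_plane_def complex_nonpos_Reals_iff)
    then obtain x where x: "z = of_real x" "1 \<le> x"
      by (metis complex_of_real_def complex_surj)
    have "(\<lambda>k. of_real (increment_tail b k * x ^ k)) sums eval_fps T z"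
      using sums_eval_fps[OF less_le_trans[OF z T_radius]] by (simp add: T_def x)
    then have s: "(\<lambda>k. increment_tail b k * x ^ k) sums Re (eval_fps T z)"
      using sums_Re by fastforce
    have "increment_tail b 0 * x ^ 0 \<le> Re (eval_fps T z)"
      using sum_le_suminf[OF sums_summable[OF s], of "{0}"] s increment_tail_nonneg[OF b] x
      by (simp add: sums_iff)
    then show ?thesis by auto
  qed
  have "inverse T = (1 - fps_X) * U"
    using fps_inverse_unique[of T "(1 - fps_X) * U"] TU by (simp add: mult_ac)
  moreover have "ereal R \<le> fps_conv_radius (inverse T)"
    using fps_conv_radius_inverse[of "ereal R" T, OF T_nonzero] T_radius by (simp add: min_absorb1)
  ultimately have "ereal R \<le> fps_conv_radius (fps_shift 1 ((1 - fps_X) * U))"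
    by simp
  also have "\<dots> = conv_radius (\<lambda>n. complex_of_real (u (Suc n) - u n))"
    unfolding fps_conv_radius_def by (simp add: left_diff_distrib U_def)
  finally show ?thesis by (rule conv_radius_from_differences[OF R])
qed

section \<open>Markov kernels acting on bounded functions\<close>

text \<open>
  These functions are integrable against all the probability measures involved and are mapped to
  each other by \<open>P\<close>. Boundedness is required on \<open>space S\<close> only, as nothing is known about \<open>P x\<close> for
  \<open>x\<close> outside it.
\<close>
definition bounded_measurable :: "'a measure \<Rightarrow> ('a \<Rightarrow> real) set" where
  "bounded_measurable S = {f \<in> borel_measurable S. \<exists>B. \<forall>x\<in>space S. \<bar>f x\<bar> \<le> B}"

lemma bounded_measurableE:
  assumes "f \<in> bounded_measurable S"
  obtains B where "f \<in> borel_measurable S" "\<And>x. x \<in> space S \<Longrightarrow> \<bar>f x\<bar> \<le> B" "0 \<le> B"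
proof -
  obtain B where B: "f \<in> borel_measurable S" "\<And>x. x \<in> space S \<Longrightarrow> \<bar>f x\<bar> \<le> B"
    using assms by (auto simp: bounded_measurable_def)
  show thesis
    by (rule that[of "max B 0"]) (use B in \<open>auto simp: le_max_iff_disj\<close>)
qed

lemma bounded_measurableI:
  "f \<in> borel_measurable S \<Longrightarrow> (\<And>x. x \<in> space S \<Longrightarrow> \<bar>f x\<bar> \<le> B) \<Longrightarrow> f \<in> bounded_measurable S"
  by (auto simp: bounded_measurable_def)

lemma bounded_measurableD [measurable_dest]: "f \<in> bounded_measurable S \<Longrightarrow> f \<in> borel_measurable S"
  by (simp add: bounded_measurable_def)

lemma bounded_measurable_const: "(\<lambda>_. c) \<in> bounded_measurable S"
  by (rule bounded_measurableI[where B = "\<bar>c\<bar>"]) auto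

lemma bounded_measurable_indicator: "C \<in> sets S \<Longrightarrow> indicator C \<in> bounded_measurable S"
  by (rule bounded_measurableI[where B = 1]) (auto simp: indicator_def)

lemma bounded_measurable_add:
  assumes "f \<in> bounded_measurable S" "g \<in> bounded_measurable S"
  shows "(\<lambda>x. f x + g x) \<in> bounded_measurable S"
proof -
  obtain A B where *: "f \<in> borel_measurable S" "\<And>x. x \<in> space S \<Longrightarrow> \<bar>f x\<bar> \<le> A"
    "g \<in> borel_measurable S" "\<And>x. x \<in> space S \<Longrightarrow> \<bar>g x\<bar> \<le> B"
    using assms by (metis bounded_measurableE)
  show ?thesis
    by (rule bounded_measurableI[where B = "A + B"])
       (use * in \<open>auto intro: order_trans[OF abs_triangle_ineq] add_mono\<close>)
qed

lemma bounded_measurable_mult: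
  assumes "f \<in> bounded_measurable S" "g \<in> bounded_measurable S"
  shows "(\<lambda>x. f x * g x) \<in> bounded_measurable S"
proof -
  obtain A B where *: "f \<in> borel_measurable S" "\<And>x. x \<in> space S \<Longrightarrow> \<bar>f x\<bar> \<le> A" "0 \<le> A"
    "g \<in> borel_measurable S" "\<And>x. x \<in> space S \<Longrightarrow> \<bar>g x\<bar> \<le> B"
    using assms by (metis bounded_measurableE)
  show ?thesis
    by (rule bounded_measurableI[where B = "A * B"])
       (use * in \<open>auto simp: abs_mult intro!: mult_mono\<close>)
qed

lemma bounded_measurable_diff:
  assumes "f \<in> bounded_measurable S" "g \<in> bounded_measurable S"
  shows "(\<lambda>x. f x - g x) \<in> bounded_measurable S"
  using bounded_measurable_add[OF assms(1) bounded_measurable_mult[OF bounded_measurable_const[of "-1"] assms(2)]]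
  by simp

lemma bounded_measurable_sum:
  assumes "\<And>i. i \<in> I \<Longrightarrow> f i \<in> bounded_measurable S"
  shows "(\<lambda>x. \<Sum>i\<in>I. f i x) \<in> bounded_measurable S"
  using assms
proof (induction I rule: infinite_finite_induct)
  case (insert i I)
  then show ?case using bounded_measurable_add[of "f i" S "\<lambda>x. \<Sum>i\<in>I. f i x"] by simp
qed (simp_all add: bounded_measurable_const)

lemma bounded_measurable_power2:
  "f \<in> bounded_measurable S \<Longrightarrow> (\<lambda>x. (f x)\<^sup>2) \<in> bounded_measurable S"
  unfolding power2_eq_square by (intro bounded_measurable_mult)

lemmas bounded_measurable_intros =
  bounded_measurable_const bounded_measurable_add bounded_measurable_mult
  bounded_measurable_diff bounded_measurable_sum bounded_measurable_power2

lemma space_eq_of_prob_algebra: "\<mu> \<in> space (prob_algebra S) \<Longrightarrow> space \<mu> = space S"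
  by (rule sets_eq_imp_space_eq) (simp add: space_prob_algebra)

lemma bounded_measurable_integrable:
  assumes "\<mu> \<in> space (prob_algebra S)" "f \<in> bounded_measurable S"
  shows "integrable \<mu> f"
proof -
  interpret prob_space \<mu> using assms by (simp add: space_prob_algebra)
  have "sets \<mu> = sets S" using assms by (simp add: space_prob_algebra)
  obtain B where "f \<in> borel_measurable S" "\<And>x. x \<in> space S \<Longrightarrow> \<bar>f x\<bar> \<le> B"
    using assms(2) by (metis bounded_measurableE)
  then show ?thesis
    using \<open>sets \<mu> = sets S\<close> sets_eq_imp_space_eq[OF \<open>sets \<mu> = sets S\<close>]
    by (intro integrable_const_bound[where B = B]) (auto cong: measurable_cong_sets)
qed

lemma integral_power2_le:
  assumes "\<mu> \<in> space (prob_algebra S)" "f \<in> bounded_measurable S"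
  shows "(\<integral>x. f x \<partial>\<mu>)\<^sup>2 \<le> (\<integral>x. (f x)\<^sup>2 \<partial>\<mu>)"
proof -
  interpret prob_space \<mu> using assms by (simp add: space_prob_algebra)
  show ?thesis
    using variance_positive[of f]
      variance_eq[OF bounded_measurable_integrable[OF assms]
        bounded_measurable_integrable[OF assms(1) bounded_measurable_power2[OF assms(2)]]]
    by linarith
qed

locale markov_kernel =
  fixes S :: "'a measure" and P :: "'a \<Rightarrow> 'a measure"
  assumes kernel: "P \<in> S \<rightarrow>\<^sub>M prob_algebra S"
begin

lemma kernel_subprob [measurable]: "P \<in> S \<rightarrow>\<^sub>M subprob_algebra S"
  using kernel by (rule measurable_prob_algebraD)

lemma kernel_space: "x \<in> space S \<Longrightarrow> P x \<in> space (prob_algebra S)"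
  using kernel by (rule measurable_space)

lemma bounded_measurable_transition_op:
  assumes "f \<in> bounded_measurable S"
  shows "transition_op P f \<in> bounded_measurable S"
proof -
  obtain B where B: "f \<in> borel_measurable S" "\<And>x. x \<in> space S \<Longrightarrow> \<bar>f x\<bar> \<le> B"
    using assms by (metis bounded_measurableE)
  show ?thesis
  proof (rule bounded_measurableI)
    show "transition_op P f \<in> borel_measurable S"
      unfolding transition_op_def using B(1) kernel_subprob
      by (rule integral_measurable_subprob_algebra[THEN measurable_compose[rotated]])
    fix x assume x: "x \<in> space S"
    interpret prob_space "P x" using kernel_space[OF x] by (simp add: space_prob_algebra)
    have sp: "space (P x) = space S"
      using kernel_space[OF x] by (rule space_eq_of_prob_algebra)
    have int: "integrable (P x) f" using kernel_space[OF x] assms by (rule bounded_measurable_integrable)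
    have "\<bar>\<integral>y. f y \<partial>P x\<bar> \<le> (\<integral>y. \<bar>f y\<bar> \<partial>P x)" by (rule integral_abs_bound)
    also have "\<dots> \<le> (\<integral>y. B \<partial>P x)"
      by (rule integral_mono) (use int B sp in auto)
    finally show "\<bar>transition_op P f x\<bar> \<le> B" by (simp add: transition_op_def prob_space)
  qed
qed

lemma bounded_measurable_transition_op_power:
  assumes "f \<in> bounded_measurable S"
  shows "(transition_op P ^^ n) f \<in> bounded_measurable S"
proof (induction n)
  case (Suc n)
  from bounded_measurable_transition_op[OF this] show ?case by simp
qed (simp add: assms)

lemma bind_kernel:
  assumes "\<mu> \<in> space (prob_algebra S)"
  shows "\<mu> \<bind> P \<in> space (prob_algebra S)"
  unfolding space_prob_algebra
  by (intro CollectI conjI sets_bind'[OF assms kernel] prob_space_bind'[OF assms kernel])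

lemma integral_bind_kernel:
  assumes "\<mu> \<in> space (prob_algebra S)" "f \<in> bounded_measurable S"
  shows "(\<integral>x. f x \<partial>(\<mu> \<bind> P)) = (\<integral>x. transition_op P f x \<partial>\<mu>)"
proof -
  interpret prob_space \<mu> using assms by (simp add: space_prob_algebra)
  have sets: "sets \<mu> = sets S" using assms by (simp add: space_prob_algebra)
  obtain B where B: "f \<in> borel_measurable S" "\<And>x. x \<in> space S \<Longrightarrow> \<bar>f x\<bar> \<le> B"
    using assms(2) by (metis bounded_measurableE)
  show ?thesis
    unfolding transition_op_def
  proof (rule integral_bind[OF B])
    show "P \<in> \<mu> \<rightarrow>\<^sub>M subprob_algebra S"
      using sets by (simp cong: measurable_cong_sets)
    show "finite_measure \<mu>" by unfold_locales
    show "AE x in \<mu>. emeasure (P x) (space (P x)) \<le> ennreal 1"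
    proof (rule AE_I2)
      fix x assume "x \<in> space \<mu>"
      then have "prob_space (P x)"
        using kernel_space[of x] sets_eq_imp_space_eq[OF sets] by (simp add: space_prob_algebra)
      then show "emeasure (P x) (space (P x)) \<le> ennreal 1"
        by (simp add: prob_space.emeasure_space_1)
    qed
  qed
qed

lemma transition_op_indicator:
  assumes "x \<in> space S" "A \<in> sets S"
  shows "transition_op P (indicator A) x = measure (P x) A"
proof -
  interpret prob_space "P x" using kernel_space[OF assms(1)] by (simp add: space_prob_algebra)
  show ?thesis
    using kernel_space[OF assms(1)] assms(2) by (simp add: transition_op_def space_prob_algebra)
qed

lemma transition_op_sum:
  assumes "x \<in> space S" "\<And>i. i \<in> I \<Longrightarrow> f i \<in> bounded_measurable S"
  shows "transition_op P (\<lambda>y. \<Sum>i\<in>I. c i * f i y) x = (\<Sum>i\<in>I. c i * transition_op P (f i) x)"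
proof -
  have "integrable (P x) (\<lambda>y. c i * f i y)" if "i \<in> I" for i
    using bounded_measurable_integrable[OF kernel_space[OF assms(1)] assms(2)[OF that]] by simp
  then show ?thesis
    unfolding transition_op_def by (simp add: Bochner_Integration.integral_sum)
qed

lemma transition_op_power2_le:
  assumes "x \<in> space S" "f \<in> bounded_measurable S"
  shows "(transition_op P f x)\<^sup>2 \<le> transition_op P (\<lambda>y. (f y)\<^sup>2) x"
  unfolding transition_op_def using kernel_space[OF assms(1)] assms(2) by (rule integral_power2_le)

text \<open>
  The operator \<open>q(P)\<close> applied to \<open>f\<close>: polynomials in \<open>P\<close> are evaluated through the pointwise sequence
  \<open>P\<^sup>j f x\<close>, so that every linear statement about \<open>q(P)\<close> becomes one about \<open>moment_functional\<close>.
\<close>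
definition polynomial_op :: "real poly \<Rightarrow> ('a \<Rightarrow> real) \<Rightarrow> 'a \<Rightarrow> real" where
  "polynomial_op q f x = moment_functional (\<lambda>j. (transition_op P ^^ j) f x) q"

lemma bounded_measurable_polynomial_op:
  assumes "f \<in> bounded_measurable S"
  shows "polynomial_op q f \<in> bounded_measurable S"
  unfolding polynomial_op_def moment_functional_def
  by (intro bounded_measurable_intros bounded_measurable_transition_op_power assms)

lemma transition_op_polynomial_op:
  assumes "x \<in> space S" "f \<in> bounded_measurable S"
  shows "transition_op P (polynomial_op q f) x = polynomial_op (pCons 0 q) f x"
  unfolding polynomial_op_def moment_functional_pCons
  unfolding moment_functional_def
  using assms by (simp add: transition_op_sum bounded_measurable_transition_op_power)

lemma integral_mult_polynomial_op:
  assumes "\<mu> \<in> space (prob_algebra S)" "f \<in> bounded_measurable S" "g \<in> bounded_measurable S"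
  shows "(\<integral>x. g x * polynomial_op q f x \<partial>\<mu>)
       = moment_functional (\<lambda>j. \<integral>x. g x * (transition_op P ^^ j) f x \<partial>\<mu>) q"
proof -
  have "integrable \<mu> (\<lambda>x. g x * (transition_op P ^^ j) f x)" for j
    using assms
    by (intro bounded_measurable_integrable[of \<mu> S] bounded_measurable_intros bounded_measurable_transition_op_power)
  then show ?thesis
    unfolding polynomial_op_def moment_functional_def
    by (simp add: sum_distrib_left mult.left_commute[of "g _"])
qed

end

locale reversible_kernel = markov_kernel S P
  for S :: "'a measure" and P :: "'a \<Rightarrow> 'a measure" +
  fixes \<pi> :: "'a measure"
  assumes inv: "invariant_prob S P \<pi>" and rev: "reversible S P \<pi>"
begin

lemma pi_prob: "\<pi> \<in> space (prob_algebra S)"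
  using inv by (simp add: invariant_prob_def)

lemma integral_transition_op:
  "f \<in> bounded_measurable S \<Longrightarrow> (\<integral>x. transition_op P f x \<partial>\<pi>) = (\<integral>x. f x \<partial>\<pi>)"
  using integral_bind_kernel[OF pi_prob, of f] inv by (simp add: invariant_prob_def)

text \<open>
  Self-adjointness of \<open>P\<close>: integrate \<open>f x g y\<close> against the two measures on \<open>S \<times> S\<close> that
  reversibility identifies.
\<close>
lemma transition_op_symmetric:
  assumes f: "f \<in> bounded_measurable S" and g: "g \<in> bounded_measurable S"
  shows "(\<integral>x. f x * transition_op P g x \<partial>\<pi>) = (\<integral>x. transition_op P f x * g x \<partial>\<pi>)"
proof -
  interpret pi: prob_space \<pi> using pi_prob by (simp add: space_prob_algebra)
  have sets: "sets \<pi> = sets S" using pi_prob by (simp add: space_prob_algebra)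
  have [measurable]: "f \<in> borel_measurable S" "g \<in> borel_measurable S"
    using f g by (auto dest: bounded_measurableD)
  obtain A where A: "\<And>x. x \<in> space S \<Longrightarrow> \<bar>f x\<bar> \<le> A" "0 \<le> A" using f by (metis bounded_measurableE)
  obtain B where B: "\<And>x. x \<in> space S \<Longrightarrow> \<bar>g x\<bar> \<le> B" using g by (metis bounded_measurableE)
  \<comment> \<open>Used with \<open>h\<close> the identity and the swap, whose image measures reversibility equates.\<close>
  have int: "(\<integral>z. f (fst z) * g (snd z) \<partial>(\<pi> \<bind> (\<lambda>x. P x \<bind> (\<lambda>y. return (S \<Otimes>\<^sub>M S) (h x y)))))
      = (\<integral>x. \<integral>y. f (fst (h x y)) * g (snd (h x y)) \<partial>P x \<partial>\<pi>)"
    if h: "(\<lambda>z. h (fst z) (snd z)) \<in> S \<Otimes>\<^sub>M S \<rightarrow>\<^sub>M S \<Otimes>\<^sub>M S" for h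
  proof -
    note [measurable] = h
    let ?F = "\<lambda>z. f (fst z) * g (snd z)"
    have bound: "\<bar>?F z\<bar> \<le> A * B" if "z \<in> space (S \<Otimes>\<^sub>M S)" for z
      unfolding abs_mult by (rule mult_mono) (use that A B in \<open>auto simp: space_pair_measure\<close>)
    have hP: "(\<lambda>x. P x \<bind> (\<lambda>y. return (S \<Otimes>\<^sub>M S) (h x y))) \<in> S \<rightarrow>\<^sub>M prob_algebra (S \<Otimes>\<^sub>M S)"
      by (rule measurable_bind_prob_space2[OF kernel]) measurable
    have "(\<integral>z. ?F z \<partial>(\<pi> \<bind> (\<lambda>x. P x \<bind> (\<lambda>y. return (S \<Otimes>\<^sub>M S) (h x y)))))
        = (\<integral>x. \<integral>z. ?F z \<partial>(P x \<bind> (\<lambda>y. return (S \<Otimes>\<^sub>M S) (h x y))) \<partial>\<pi>)"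
    proof (rule integral_bind[where K = "S \<Otimes>\<^sub>M S" and B = "A * B" and B' = 1])
      show "(\<lambda>x. P x \<bind> (\<lambda>y. return (S \<Otimes>\<^sub>M S) (h x y))) \<in> \<pi> \<rightarrow>\<^sub>M subprob_algebra (S \<Otimes>\<^sub>M S)"
        using measurable_prob_algebraD[OF hP] sets by (simp cong: measurable_cong_sets)
      show "AE x in \<pi>. emeasure (P x \<bind> (\<lambda>y. return (S \<Otimes>\<^sub>M S) (h x y)))
              (space (P x \<bind> (\<lambda>y. return (S \<Otimes>\<^sub>M S) (h x y)))) \<le> ennreal 1"
        using measurable_space[OF hP] sets_eq_imp_space_eq[OF sets]
        by (auto simp: space_prob_algebra prob_space.emeasure_space_1 intro!: AE_I2)
    qed (use bound in \<open>auto intro: pi.finite_measure_axioms\<close>)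
    also have "\<dots> = (\<integral>x. \<integral>y. ?F (h x y) \<partial>P x \<partial>\<pi>)"
    proof (rule Bochner_Integration.integral_cong[OF refl])
      fix x assume "x \<in> space \<pi>"
      then have x: "x \<in> space S" using sets_eq_imp_space_eq[OF sets] by simp
      interpret px: prob_space "P x" using kernel_space[OF x] by (simp add: space_prob_algebra)
      have sx [measurable_cong]: "sets (P x) = sets S" using kernel_space[OF x] by (simp add: space_prob_algebra)
      have hx: "h x \<in> P x \<rightarrow>\<^sub>M S \<Otimes>\<^sub>M S"
        using measurable_compose[OF measurable_Pair1'[OF x] h] sx by (simp cong: measurable_cong_sets)
      have "P x \<bind> (\<lambda>y. return (S \<Otimes>\<^sub>M S) (h x y)) = distr (P x) (S \<Otimes>\<^sub>M S) (h x)"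
        by (rule bind_return_distr'[OF px.not_empty hx])
      then show "(\<integral>z. ?F z \<partial>(P x \<bind> (\<lambda>y. return (S \<Otimes>\<^sub>M S) (h x y)))) = (\<integral>y. ?F (h x y) \<partial>P x)"
        by (simp add: integral_distr[OF hx])
    qed
    finally show ?thesis .
  qed
  have "(\<integral>x. f x * transition_op P g x \<partial>\<pi>) = (\<integral>x. \<integral>y. f x * g y \<partial>P x \<partial>\<pi>)"
    by (simp add: transition_op_def)
  also have "\<dots> = (\<integral>x. \<integral>y. f y * g x \<partial>P x \<partial>\<pi>)"
    using int[of "\<lambda>x y. (x, y)"] int[of "\<lambda>x y. (y, x)"] rev by (simp add: reversible_def)
  also have "\<dots> = (\<integral>x. transition_op P f x * g x \<partial>\<pi>)"
    by (simp add: transition_op_def)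
  finally show ?thesis .
qed

text \<open>
  For the chain started from \<open>\<pi>\<close> this is the expectation of \<open>f(X\<^sub>0) f(X\<^sub>n)\<close>, a covariance when
  \<open>f\<close> has mean \<open>0\<close>.
\<close>
definition autocovariance :: "('a \<Rightarrow> real) \<Rightarrow> nat \<Rightarrow> real" where
  "autocovariance f n = (\<integral>x. f x * (transition_op P ^^ n) f x \<partial>\<pi>)"

lemma integral_power_mult_power:
  assumes f: "f \<in> bounded_measurable S"
  shows "(\<integral>x. (transition_op P ^^ i) f x * (transition_op P ^^ j) f x \<partial>\<pi>) = autocovariance f (i + j)"
proof (induction i arbitrary: j)
  case (Suc i)
  have "(\<integral>x. (transition_op P ^^ Suc i) f x * (transition_op P ^^ j) f x \<partial>\<pi>)
      = (\<integral>x. (transition_op P ^^ i) f x * (transition_op P ^^ Suc j) f x \<partial>\<pi>)"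
    using transition_op_symmetric[of "(transition_op P ^^ i) f" "(transition_op P ^^ j) f"] f
    by (simp add: bounded_measurable_transition_op_power)
  also have "\<dots> = autocovariance f (i + Suc j)" by (rule Suc.IH)
  finally show ?case by simp
qed (simp add: autocovariance_def)

text \<open>
  Self-adjointness collapses \<open>\<langle>p(P) f, q(P) f\<rangle>\<close> to \<open>\<langle>f, (p q)(P) f\<rangle>\<close>. The positivity
  hypotheses on the moment functional of \<open>autocovariance f\<close> are obtained from it.
\<close>
lemma integral_polynomial_op_mult:
  assumes f: "f \<in> bounded_measurable S"
  shows "(\<integral>x. polynomial_op p f x * polynomial_op q f x \<partial>\<pi>) = moment_functional (autocovariance f) (p * q)"
proof -
  note bm = bounded_measurable_polynomial_op[OF f] bounded_measurable_transition_op_power[OF f]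
  have "(\<integral>x. polynomial_op q f x * (transition_op P ^^ i) f x \<partial>\<pi>)
      = moment_functional (\<lambda>j. autocovariance f (i + j)) q" for i
    using integral_mult_polynomial_op[OF pi_prob f bm(2), of i q]
    by (simp add: integral_power_mult_power[OF f] mult.commute add.commute)
  then show ?thesis
    using integral_mult_polynomial_op[OF pi_prob f bm(1), of q p]
    by (simp add: moment_functional_mult mult.commute)
qed

text \<open>
  This is \<open>1 - P \<ge> 0\<close> on \<open>L\<^sup>2(\<pi>)\<close>: \<open>2 g Pg \<le> g\<^sup>2 + (Pg)\<^sup>2 \<le> g\<^sup>2 + P(g\<^sup>2)\<close>, and the last
  two terms have equal integrals by invariance.
\<close>
lemma integral_transition_op_mult_le:
  assumes g: "g \<in> bounded_measurable S"
  shows "(\<integral>x. g x * transition_op P g x \<partial>\<pi>) \<le> (\<integral>x. (g x)\<^sup>2 \<partial>\<pi>)"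
proof -
  have sp: "space \<pi> = space S"
    using pi_prob by (rule space_eq_of_prob_algebra)
  note bm = g bounded_measurable_transition_op[OF g] bounded_measurable_power2[OF g]
    bounded_measurable_transition_op[OF bounded_measurable_power2[OF g]]
  note int = bounded_measurable_integrable[OF pi_prob]
  have "(\<integral>x. 2 * (g x * transition_op P g x) \<partial>\<pi>)
      \<le> (\<integral>x. (g x)\<^sup>2 + transition_op P (\<lambda>y. (g y)\<^sup>2) x \<partial>\<pi>)"
  proof (rule integral_mono)
    fix x assume "x \<in> space \<pi>"
    then have "(transition_op P g x)\<^sup>2 \<le> transition_op P (\<lambda>y. (g y)\<^sup>2) x"
      using g sp by (simp add: transition_op_power2_le)
    moreover have "2 * (g x * transition_op P g x) \<le> (g x)\<^sup>2 + (transition_op P g x)\<^sup>2"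
      using sum_squares_bound[of "g x" "transition_op P g x"] by (simp add: mult.assoc)
    ultimately show "2 * (g x * transition_op P g x) \<le> (g x)\<^sup>2 + transition_op P (\<lambda>y. (g y)\<^sup>2) x"
      by linarith
  qed (intro int bounded_measurable_intros bm)+
  also have "\<dots> = 2 * (\<integral>x. (g x)\<^sup>2 \<partial>\<pi>)"
    using bm by (simp add: Bochner_Integration.integral_add int integral_transition_op)
  finally show ?thesis by simp
qed

lemma moment_functional_autocovariance_nonneg:
  assumes f: "f \<in> bounded_measurable S"
  shows "0 \<le> moment_functional (autocovariance f) (q\<^sup>2)"
  using Bochner_Integration.integral_nonneg[of \<pi> "\<lambda>x. polynomial_op q f x * polynomial_op q f x"]
  unfolding power2_eq_square integral_polynomial_op_mult[OF f, symmetric] by simp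

lemma moment_functional_autocovariance_shift:
  assumes f: "f \<in> bounded_measurable S"
  shows "(\<integral>x. polynomial_op q f x * transition_op P (polynomial_op q f) x \<partial>\<pi>)
    = moment_functional (autocovariance f) ([:0, 1:] * q\<^sup>2)"
proof -
  have sp: "space \<pi> = space S"
    using pi_prob by (rule space_eq_of_prob_algebra)
  have "(\<integral>x. polynomial_op q f x * transition_op P (polynomial_op q f) x \<partial>\<pi>)
      = (\<integral>x. polynomial_op q f x * polynomial_op (pCons 0 q) f x \<partial>\<pi>)"
    by (rule Bochner_Integration.integral_cong) (simp_all add: transition_op_polynomial_op f sp)
  also have "\<dots> = moment_functional (autocovariance f) ([:0, 1:] * q\<^sup>2)"
    unfolding integral_polynomial_op_mult[OF f] by (simp add: power2_eq_square)
  finally show ?thesis .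
qed

lemma moment_functional_autocovariance_contraction:
  assumes f: "f \<in> bounded_measurable S"
  shows "0 \<le> moment_functional (autocovariance f) ([:1, -1:] * q\<^sup>2)"
proof -
  have split: "[:1, -1:] * q\<^sup>2 = q\<^sup>2 - [:0, 1:] * q\<^sup>2" by (simp add: mult_pCons_left)
  have "moment_functional (autocovariance f) ([:0, 1:] * q\<^sup>2)
      \<le> moment_functional (autocovariance f) (q\<^sup>2)"
    using integral_transition_op_mult_le[OF bounded_measurable_polynomial_op[OF f], of q]
      integral_polynomial_op_mult[OF f, of q q]
    unfolding moment_functional_autocovariance_shift[OF f] by (simp add: power2_eq_square)
  then show ?thesis unfolding split moment_functional_diff by simp
qed

text \<open>
  The quadratic \<open>t \<mapsto> \<parallel>t f - P\<^sup>n f\<parallel>\<^sup>2\<close> is nonnegative; minimize it over \<open>t\<close>.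
\<close>
lemma autocovariance_Cauchy_Schwarz:
  assumes f: "f \<in> bounded_measurable S"
  shows "(autocovariance f n)\<^sup>2 \<le> autocovariance f 0 * autocovariance f (2 * n)"
proof -
  let ?s = "autocovariance f"
  have quad: "0 \<le> t\<^sup>2 * ?s 0 - 2 * t * ?s n + ?s (2 * n)" for t
  proof -
    have "(smult t 1 - monom 1 n)\<^sup>2
        = smult (t * t) 1 - smult t (monom 1 n) - smult t (monom 1 n) + monom 1 (n + n)"
      unfolding power2_eq_square left_diff_distrib right_diff_distrib
      by (simp add: mult_monom)
    note square = this
    have "moment_functional ?s ((smult t 1 - monom 1 n)\<^sup>2)
        = t * t * ?s 0 - t * ?s n - t * ?s n + ?s (n + n)"
      unfolding square moment_functional_add moment_functional_diff moment_functional_smult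
        moment_functional_monom moment_functional_1 by simp
    also have "\<dots> = t\<^sup>2 * ?s 0 - 2 * t * ?s n + ?s (2 * n)"
      unfolding mult_2[of n] by (simp add: power2_eq_square)
    finally show ?thesis
      using moment_functional_autocovariance_nonneg[OF f, of "smult t 1 - monom 1 n"] by linarith
  qed
  have "0 \<le> ?s 0" using moment_functional_autocovariance_nonneg[OF f, of 1] by simp
  show ?thesis
  proof (cases "?s 0 = 0")
    case True
    have "?s n = 0"
    proof (rule ccontr)
      assume "?s n \<noteq> 0"
      \<comment> \<open>Without its leading term the quadratic is affine in \<open>t\<close>; it takes the value \<open>-1\<close> at this point.\<close>
      then have "2 * ((?s (2 * n) + 1) / (2 * ?s n)) * ?s n = ?s (2 * n) + 1" by simp
      with quad[of "(?s (2 * n) + 1) / (2 * ?s n)"] True show False by simp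
    qed
    with True show ?thesis by simp
  next
    case False
    with \<open>0 \<le> ?s 0\<close> have pos: "0 < ?s 0" by simp
    \<comment> \<open>The quadratic attains its minimum at \<open>?s n / ?s 0\<close>.\<close>
    have "(?s n / ?s 0)\<^sup>2 * ?s 0 - 2 * (?s n / ?s 0) * ?s n + ?s (2 * n) = ?s (2 * n) - (?s n)\<^sup>2 / ?s 0"
      using pos by (simp add: power2_eq_square)
    with quad[of "?s n / ?s 0"] have "(?s n)\<^sup>2 / ?s 0 \<le> ?s (2 * n)" by simp
    then show ?thesis using pos by (simp add: divide_le_eq mult.commute)
  qed
qed

end

text \<open>
  Taking expectations in the Markov property gives \<open>law (n + 1) = law n \<bind> P\<close>; the powers of
  \<open>P\<close> are then moved from the law to the function.
\<close>
lemma markov_chain_expectation: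
  assumes "markov_kernel S P" and nu: "\<nu> \<in> space (prob_algebra S)"
    and chain: "markov_chain \<Omega> S P \<nu> X" and A: "A \<in> sets S"
  shows "measure \<Omega> {\<omega> \<in> space \<Omega>. X n \<omega> \<in> A} = (\<integral>x. (transition_op P ^^ n) (indicator A) x \<partial>\<nu>)"
proof -
  interpret markov_kernel S P by fact
  interpret prob_space \<Omega> using chain by (simp add: markov_chain_def)
  have X [measurable]: "X n \<in> \<Omega> \<rightarrow>\<^sub>M S" for n using chain by (simp add: markov_chain_def)
  define law where "law n = distr \<Omega> S (X n)" for n
  have law: "law n \<in> space (prob_algebra S)" for n
    by (simp add: law_def space_prob_algebra prob_space_distr)
  have law_Suc: "law (Suc n) = law n \<bind> P" for n
  proof (rule measure_eqI)
    show "sets (law (Suc n)) = sets (law n \<bind> P)"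
      using law[of "Suc n"] bind_kernel[OF law[of n]] by (simp add: space_prob_algebra)
    fix A assume "A \<in> sets (law (Suc n))"
    then have A [measurable]: "A \<in> sets S" by (simp add: law_def)
    have "subalgebra \<Omega> (history \<Omega> S X n)"
    proof -
      let ?h = "\<lambda>\<omega>. \<lambda>i\<in>{..n}. X i \<omega>" and ?M = "\<Pi>\<^sub>M i\<in>{..n}. S"
      have h: "?h \<in> \<Omega> \<rightarrow>\<^sub>M ?M" by measurable
      have "?h \<in> space \<Omega> \<rightarrow> space ?M" using measurable_space[OF h] by (rule funcsetI)
      then have "sets (history \<Omega> S X n) = {?h -` B \<inter> space \<Omega> | B. B \<in> sets ?M}"
        unfolding history_def by (rule sets_vimage_algebra2)
      then have "sets (history \<Omega> S X n) \<subseteq> sets \<Omega>" using measurable_sets[OF h] by auto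
      then show ?thesis by (simp add: subalgebra_def history_def)
    qed
    then interpret finite_measure_subalgebra \<Omega> "history \<Omega> S X n"
      by unfold_locales
    have P_meas: "(\<lambda>x. measure (P x) A) \<in> borel_measurable S"
      using kernel A by measurable
    have "measure (law (Suc n)) A = (\<integral>\<omega>. indicator (X (Suc n) -` A \<inter> space \<Omega>) \<omega> \<partial>\<Omega>)"
      by (simp add: law_def measure_distr)
    also have "\<dots> = (\<integral>\<omega>. real_cond_exp \<Omega> (history \<Omega> S X n) (indicator (X (Suc n) -` A \<inter> space \<Omega>)) \<omega> \<partial>\<Omega>)"
      by (rule real_cond_exp_int(2)[symmetric])
         (intro integrable_real_indicator measurable_sets[OF X A], simp add: emeasure_eq_measure)
    also have "\<dots> = (\<integral>\<omega>. measure (P (X n \<omega>)) A \<partial>\<Omega>)"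
    proof (rule integral_cong_AE)
      show "AE \<omega> in \<Omega>. real_cond_exp \<Omega> (history \<Omega> S X n) (indicator (X (Suc n) -` A \<inter> space \<Omega>)) \<omega>
          = measure (P (X n \<omega>)) A"
        using chain A by (simp add: markov_chain_def)
      show "(\<lambda>\<omega>. measure (P (X n \<omega>)) A) \<in> borel_measurable \<Omega>"
        by (rule measurable_compose[OF X P_meas])
    qed simp
    also have "\<dots> = (\<integral>x. measure (P x) A \<partial>law n)"
      unfolding law_def by (rule integral_distr[symmetric]) (use P_meas in simp_all)
    also have "\<dots> = (\<integral>x. transition_op P (indicator A) x \<partial>law n)"
      using law[of n] by (intro Bochner_Integration.integral_cong)
        (simp_all add: space_eq_of_prob_algebra transition_op_indicator)
    also have "\<dots> = (\<integral>x. indicator A x \<partial>(law n \<bind> P))"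
      by (rule integral_bind_kernel[OF law bounded_measurable_indicator[OF A], symmetric])
    also have "\<dots> = measure (law n \<bind> P) A"
      using bind_kernel[OF law[of n]] A by (simp add: space_prob_algebra)
    finally show "emeasure (law (Suc n)) A = emeasure (law n \<bind> P) A"
      using law[of "Suc n"] bind_kernel[OF law[of n]]
      by (simp add: space_prob_algebra finite_measure.emeasure_eq_measure prob_space_def)
  qed
  have "(\<integral>x. f x \<partial>law n) = (\<integral>x. (transition_op P ^^ n) f x \<partial>\<nu>)" if "f \<in> bounded_measurable S" for f
    using that
  proof (induction n arbitrary: f)
    case 0
    then show ?case using chain by (simp add: law_def markov_chain_def)
  next
    case (Suc n)
    then show ?case
      using integral_bind_kernel[OF law Suc.prems] bounded_measurable_transition_op[OF Suc.prems]
      by (simp add: law_Suc funpow_swap1)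
  qed
  from this[OF bounded_measurable_indicator[OF A]]
  have "measure (law n) A = (\<integral>x. (transition_op P ^^ n) (indicator A) x \<partial>\<nu>)"
    using A by (simp add: law_def)
  moreover have "{\<omega> \<in> space \<Omega>. X n \<omega> \<in> A} = X n -` A \<inter> space \<Omega>" by auto
  ultimately show ?thesis using A by (simp add: law_def measure_distr)
qed

section \<open>Minorization and positive recurrence\<close>

locale minorized_kernel = markov_kernel S P
  for S :: "'a measure" and P :: "'a \<Rightarrow> 'a measure" +
  fixes C :: "'a set" and \<nu> :: "'a measure" and \<beta>' :: real
  assumes C: "C \<in> sets S" and beta': "0 < \<beta>'" and nu: "\<nu> \<in> space (prob_algebra S)"
    and minor: "\<And>x A. x \<in> space S \<Longrightarrow> A \<in> sets S \<Longrightarrow>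
                  \<beta>' * indicator C x * measure \<nu> A \<le> measure (P x) A"
begin

text \<open>
  The measure inequality \<open>\<beta>' \<mu>(C) \<nu> \<le> \<mu>\<close>, integrated against \<open>f\<close>. On sets it
  results from integrating the minorization over \<open>\<mu>\<close>.
\<close>
lemma integral_le_invariant:
  assumes mu: "invariant_prob S P \<mu>" and f: "f \<in> bounded_measurable S"
    and f_nonneg: "\<And>x. x \<in> space S \<Longrightarrow> 0 \<le> f x"
  shows "\<beta>' * measure \<mu> C * (\<integral>x. f x \<partial>\<nu>) \<le> (\<integral>x. f x \<partial>\<mu>)"
proof -
  have mup: "\<mu> \<in> space (prob_algebra S)" using mu by (simp add: invariant_prob_def)
  interpret mu: prob_space \<mu> using mup by (simp add: space_prob_algebra)
  interpret nu: prob_space \<nu> using nu by (simp add: space_prob_algebra)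
  have sets: "sets \<mu> = sets S" "sets \<nu> = sets S" using mup nu by (simp_all add: space_prob_algebra)
  note space = space_eq_of_prob_algebra[OF mup] space_eq_of_prob_algebra[OF nu]
  define c where "c = \<beta>' * measure \<mu> C"
  have c: "0 \<le> c" using beta' by (simp add: c_def)
  have "c * measure \<nu> A \<le> measure \<mu> A" if A: "A \<in> sets S" for A
  proof -
    have "c * measure \<nu> A = (\<integral>x. \<beta>' * indicator C x * measure \<nu> A \<partial>\<mu>)"
      using C sets by (simp add: c_def)
    also have "\<dots> \<le> (\<integral>x. transition_op P (indicator A) x \<partial>\<mu>)"
    proof (rule integral_mono)
      show "integrable \<mu> (\<lambda>x. \<beta>' * indicator C x * measure \<nu> A)"
        using bounded_measurable_integrable[OF mup bounded_measurable_indicator[OF C]] by simp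
      show "integrable \<mu> (transition_op P (indicator A))"
        by (intro bounded_measurable_integrable[OF mup] bounded_measurable_transition_op
              bounded_measurable_indicator A)
    qed (use minor A space in \<open>simp add: transition_op_indicator\<close>)
    also have "\<dots> = (\<integral>x. indicator A x \<partial>\<mu>)"
      using integral_bind_kernel[OF mup bounded_measurable_indicator[OF A]] mu
      by (simp add: invariant_prob_def)
    also have "\<dots> = measure \<mu> A" using A sets by simp
    finally show ?thesis .
  qed
  then have "emeasure (scale_measure (ennreal c) \<nu>) A \<le> emeasure \<mu> A" if "A \<in> sets S" for A
    using that c by (simp add: mu.emeasure_eq_measure nu.emeasure_eq_measure flip: ennreal_mult)
  then have le: "scale_measure (ennreal c) \<nu> \<le> \<mu>"
    using sets by (simp add: le_measure)
  have "ennreal c * (\<integral>\<^sup>+x. ennreal (f x) \<partial>\<nu>) = (\<integral>\<^sup>+x. ennreal (f x) \<partial>scale_measure (ennreal c) \<nu>)"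
    using f sets by (intro nn_integral_scale_measure[symmetric])
       (auto dest!: bounded_measurableD cong: measurable_cong_sets)
  also have "\<dots> \<le> (\<integral>\<^sup>+x. ennreal (f x) \<partial>\<mu>)"
    by (rule nn_integral_mono_measure) (use sets le in simp_all)
  also have "\<dots> = ennreal (\<integral>x. f x \<partial>\<mu>)"
    by (rule nn_integral_eq_integral[OF bounded_measurable_integrable[OF mup f]])
       (use f_nonneg space in auto)
  also have "(\<integral>\<^sup>+x. ennreal (f x) \<partial>\<nu>) = ennreal (\<integral>x. f x \<partial>\<nu>)"
    by (rule nn_integral_eq_integral[OF bounded_measurable_integrable[OF nu f]])
       (use f_nonneg space in auto)
  finally have "ennreal (c * (\<integral>x. f x \<partial>\<nu>)) \<le> ennreal (\<integral>x. f x \<partial>\<mu>)"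
    using c by (simp add: ennreal_mult')
  moreover have "0 \<le> (\<integral>x. f x \<partial>\<mu>)"
    by (rule Bochner_Integration.integral_nonneg) (use f_nonneg space in simp)
  ultimately show ?thesis by (simp add: c_def)
qed

end

text \<open>
  Setwise identities between measures transfer to integrals. This is the form in which a step of the
  chain splits into its regenerating and its non-regenerating part.
\<close>
lemma nn_integral_measure_add:
  fixes M N K :: "'a measure"
  assumes sets: "sets N = sets M" "sets K = sets M"
    and add: "\<And>A. A \<in> sets M \<Longrightarrow> emeasure M A = emeasure N A + c * emeasure K A"
    and f: "f \<in> borel_measurable M"
  shows "(\<integral>\<^sup>+x. f x \<partial>M) = (\<integral>\<^sup>+x. f x \<partial>N) + c * (\<integral>\<^sup>+x. f x \<partial>K)"
  using f
proof (induction rule: borel_measurable_induct)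
  note [simp] = sets_eq_imp_space_eq[OF sets(1)] sets_eq_imp_space_eq[OF sets(2)]
  note [measurable_cong] = sets
  {
    case (cong f g)
    have "(\<integral>\<^sup>+x. f x \<partial>L) = (\<integral>\<^sup>+x. g x \<partial>L)" if "space L = space M" for L
      by (rule nn_integral_cong) (use cong that in simp)
    then show ?case using cong.IH by simp
  next
    case (set A)
    then show ?case using add[of A] sets by simp
  next
    case (mult u d)
    then have [measurable]: "u \<in> borel_measurable M" by simp
    show ?case
      using mult.IH by (simp add: nn_integral_cmult distrib_left mult.left_commute)
  next
    case (add u v)
    then have [measurable]: "u \<in> borel_measurable M" "v \<in> borel_measurable M" by simp_all
    show ?case
      using add.IH by (simp add: nn_integral_add distrib_left ac_simps)
  next
    case (seq U)
    then have [measurable]: "\<And>i. U i \<in> borel_measurable M" by simp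
    have mono: "incseq (\<lambda>i. \<integral>\<^sup>+x. U i x \<partial>L)" for L
      using \<open>incseq U\<close> by (auto intro!: nn_integral_mono monoI simp: incseq_def le_fun_def)
    have sup: "(\<integral>\<^sup>+x. (SUP i. U i) x \<partial>L) = (SUP i. \<integral>\<^sup>+x. U i x \<partial>L)" if "sets L = sets M" for L
      using that \<open>incseq U\<close>
      by (simp add: image_comp nn_integral_monotone_convergence_SUP cong: measurable_cong_sets)
    have "(\<integral>\<^sup>+x. (SUP i. U i) x \<partial>M) = (SUP i. (\<integral>\<^sup>+x. U i x \<partial>N) + c * (\<integral>\<^sup>+x. U i x \<partial>K))"
      unfolding sup[OF refl] using seq.IH by simp
    also have "\<dots> = (SUP i. \<integral>\<^sup>+x. U i x \<partial>N) + (SUP i. c * (\<integral>\<^sup>+x. U i x \<partial>K))"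
      by (rule ennreal_SUP_add[OF mono]) (use mono[of K] in \<open>auto simp: incseq_def intro: mult_left_mono\<close>)
    also have "\<dots> = (\<integral>\<^sup>+x. (SUP i. U i) x \<partial>N) + c * (\<integral>\<^sup>+x. (SUP i. U i) x \<partial>K)"
      unfolding sup[OF sets(1)] sup[OF sets(2)] by (simp add: SUP_mult_left_ennreal)
    finally show ?case .
  }
qed

context minorized_kernel
begin

text \<open>
  The measures \<open>\<nu> Q\<^sup>k\<close> with \<open>Q = P - \<beta>' 1\<^sub>C \<otimes> \<nu>\<close>. If each visit to \<open>C\<close> is followed,
  with probability \<open>\<beta>'\<close>, by a fresh start from \<open>\<nu>\<close>, this is the law of the chain at time \<open>k\<close> on the event
  that it has not been restarted since time \<open>0\<close>. Subtracting measures one step at a time avoids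
  constructing \<open>Q\<close> as a kernel.
\<close>
primrec unregenerated :: "nat \<Rightarrow> 'a measure" where
  "unregenerated 0 = \<nu>"
| "unregenerated (Suc k) = diff_measure (unregenerated k \<bind> P)
     (scale_measure (ennreal \<beta>' * emeasure (unregenerated k) C) \<nu>)"

declare unregenerated.simps(2) [simp del]

text \<open>
  The minorization, integrated over \<open>\<mu>\<close>, says exactly that the restarted mass can be subtracted
  from \<open>\<mu> P\<close> without leaving a negative measure.
\<close>
lemma regeneration_step:
  assumes mu: "\<mu> \<in> space (subprob_algebra S)"
  defines "\<mu>' \<equiv> diff_measure (\<mu> \<bind> P) (scale_measure (ennreal \<beta>' * emeasure \<mu> C) \<nu>)"
  shows "\<mu>' \<in> space (subprob_algebra S)"
    and "A \<in> sets S \<Longrightarrow> emeasure (\<mu> \<bind> P) A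
      = emeasure \<mu>' A + ennreal \<beta>' * emeasure \<mu> C * emeasure \<nu> A"
proof -
  interpret subprob_space \<mu> using mu by (simp add: space_subprob_algebra)
  interpret nu: prob_space \<nu> using nu by (simp add: space_prob_algebra)
  have sets_mu: "sets \<mu> = sets S" and sets_nu: "sets \<nu> = sets S"
    using mu nu by (simp_all add: space_subprob_algebra space_prob_algebra)
  have space_mu: "space \<mu> = space S" by (rule sets_eq_imp_space_eq[OF sets_mu])
  have kernel_mu: "P \<in> \<mu> \<rightarrow>\<^sub>M subprob_algebra S"
    using kernel_subprob sets_mu by (simp cong: measurable_cong_sets)
  have step: "subprob_space (\<mu> \<bind> P)"
    using subprob_space_axioms kernel_mu by (rule subprob_space_bind)
  have sets_step: "sets (\<mu> \<bind> P) = sets S"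
    by (rule sets_bind[OF _ subprob_not_empty])
       (use kernel_space space_mu in \<open>simp add: space_prob_algebra\<close>)
  have le: "ennreal \<beta>' * emeasure \<mu> C * emeasure \<nu> A \<le> emeasure (\<mu> \<bind> P) A" if A: "A \<in> sets S" for A
  proof -
    have "ennreal \<beta>' * emeasure \<mu> C * emeasure \<nu> A
        = (\<integral>\<^sup>+x. (ennreal \<beta>' * emeasure \<nu> A) * indicator C x \<partial>\<mu>)"
      by (subst nn_integral_cmult_indicator) (use C sets_mu in \<open>simp_all add: mult_ac\<close>)
    also have "\<dots> \<le> (\<integral>\<^sup>+x. emeasure (P x) A \<partial>\<mu>)"
    proof (rule nn_integral_mono)
      fix x assume "x \<in> space \<mu>"
      then have x: "x \<in> space S" using space_mu by simp
      interpret px: prob_space "P x" using kernel_space[OF x] by (simp add: space_prob_algebra)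
      have "ennreal (\<beta>' * indicator C x * measure \<nu> A) \<le> ennreal (measure (P x) A)"
        by (rule ennreal_leI[OF minor[OF x A]])
      then show "(ennreal \<beta>' * emeasure \<nu> A) * indicator C x \<le> emeasure (P x) A"
        using beta' by (cases "x \<in> C") (simp_all add: nu.emeasure_eq_measure px.emeasure_eq_measure ennreal_mult')
    qed
    also have "\<dots> = emeasure (\<mu> \<bind> P) A"
      by (rule emeasure_bind[OF subprob_not_empty kernel_mu A, symmetric])
    finally show ?thesis .
  qed
  let ?N = "scale_measure (ennreal \<beta>' * emeasure \<mu> C) \<nu>"
  have finite_N: "emeasure ?N A < \<infinity>" for A
    by (simp add: emeasure_eq_measure nu.emeasure_eq_measure ennreal_mult_less_top)
  have diff: "emeasure \<mu>' A = emeasure (\<mu> \<bind> P) A - emeasure ?N A" if "A \<in> sets S" for A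
    unfolding \<mu>'_def
  proof (rule emeasure_diff_measure)
    show "finite_measure (\<mu> \<bind> P)" using step by (simp add: subprob_space_def)
    show "finite_measure ?N" by (rule finite_measureI[OF less_imp_neq[OF finite_N]])
  qed (use that le sets_step sets_nu in simp_all)
  show "emeasure (\<mu> \<bind> P) A = emeasure \<mu>' A + ennreal \<beta>' * emeasure \<mu> C * emeasure \<nu> A"
    if "A \<in> sets S" for A
    using diff_add_cancel_ennreal[OF le[OF that]] that by (simp add: diff)
  have "emeasure \<mu>' (space S) \<le> emeasure (\<mu> \<bind> P) (space S)"
    by (simp add: diff diff_le_self_ennreal)
  also have "\<dots> \<le> 1"
    using subprob_space.emeasure_space_le_1[OF step] sets_eq_imp_space_eq[OF sets_step] by simp
  finally show "\<mu>' \<in> space (subprob_algebra S)"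
    using sets_step subprob_not_empty space_mu sets_eq_imp_space_eq[OF sets_step]
    by (auto simp: space_subprob_algebra \<mu>'_def intro!: subprob_spaceI)
qed

lemma unregenerated_subprob: "unregenerated k \<in> space (subprob_algebra S)"
proof (induction k)
  case 0
  then show ?case using nu by (simp add: space_subprob_algebra space_prob_algebra prob_space_imp_subprob_space)
next
  case (Suc k)
  then show ?case using regeneration_step(1) by (simp add: unregenerated.simps(2))
qed

lemma emeasure_unregenerated_Suc:
  "A \<in> sets S \<Longrightarrow> emeasure (unregenerated k \<bind> P) A
     = emeasure (unregenerated (Suc k)) A + ennreal \<beta>' * emeasure (unregenerated k) C * emeasure \<nu> A"
  using regeneration_step(2)[OF unregenerated_subprob, of A k] by (simp add: unregenerated.simps(2))

abbreviation regeneration_prob :: "nat \<Rightarrow> real" where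
  "regeneration_prob k \<equiv> \<beta>' * measure (unregenerated k) C"

lemma regeneration_prob_ennreal:
  "ennreal \<beta>' * emeasure (unregenerated k) C = ennreal (regeneration_prob k)"
proof -
  interpret subprob_space "unregenerated k"
    using unregenerated_subprob[of k] by (simp add: space_subprob_algebra)
  show ?thesis using beta' by (simp add: emeasure_eq_measure ennreal_mult')
qed

lemma integral_transition_op_unregenerated:
  assumes f: "f \<in> bounded_measurable S" and nonneg: "\<And>x. x \<in> space S \<Longrightarrow> 0 \<le> f x"
  shows "(\<integral>x. transition_op P f x \<partial>unregenerated k)
    = (\<integral>x. f x \<partial>unregenerated (Suc k)) + regeneration_prob k * (\<integral>x. f x \<partial>\<nu>)"
proof -
  let ?m = "unregenerated k"
  interpret subprob_space ?m using unregenerated_subprob[of k] by (simp add: space_subprob_algebra)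
  have sets: "sets (unregenerated j) = sets S" for j
    using unregenerated_subprob[of j] by (simp add: space_subprob_algebra)
  have sets_nu: "sets \<nu> = sets S" using nu by (simp add: space_prob_algebra)
  note space = sets_eq_imp_space_eq[OF sets] sets_eq_imp_space_eq[OF sets_nu]
  have kernel_m: "P \<in> ?m \<rightarrow>\<^sub>M subprob_algebra S"
    using kernel_subprob sets[of k] by (simp cong: measurable_cong_sets)
  have sets_step: "sets (?m \<bind> P) = sets S"
    by (rule sets_bind[OF _ subprob_not_empty])
       (use kernel_space space in \<open>simp add: space_prob_algebra\<close>)
  obtain B where B: "f \<in> borel_measurable S" "\<And>x. x \<in> space S \<Longrightarrow> \<bar>f x\<bar> \<le> B"
    using f by (metis bounded_measurableE)
  have int: "integrable M f \<and> 0 \<le> (\<integral>x. f x \<partial>M) \<and> (\<integral>\<^sup>+x. ennreal (f x) \<partial>M) = ennreal (\<integral>x. f x \<partial>M)"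
    if M: "finite_measure M" "sets M = sets S" for M
  proof -
    interpret M: finite_measure M by fact
    have sp: "space M = space S" using M(2) by (rule sets_eq_imp_space_eq)
    have "integrable M f"
      using B sp M(2) by (intro M.integrable_const_bound[where B = B]) (auto cong: measurable_cong_sets)
    then show ?thesis
      using nonneg sp by (auto intro!: nn_integral_eq_integral Bochner_Integration.integral_nonneg)
  qed
  have fin: "finite_measure (?m \<bind> P)" "finite_measure (unregenerated (Suc k))" "finite_measure \<nu>"
    using subprob_space_bind[OF subprob_space_axioms kernel_m] unregenerated_subprob[of "Suc k"] nu
    by (simp_all add: subprob_space_def space_subprob_algebra space_prob_algebra prob_space_def)
  note ints = int[OF fin(1) sets_step] int[OF fin(2) sets] int[OF fin(3) sets_nu]
  have "(\<integral>x. transition_op P f x \<partial>?m) = (\<integral>x. f x \<partial>(?m \<bind> P))"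
    unfolding transition_op_def
  proof (rule integral_bind[OF B kernel_m, symmetric])
    show "AE x in ?m. emeasure (P x) (space (P x)) \<le> ennreal 1"
      using kernel_space space
      by (intro AE_I2) (simp add: space_prob_algebra prob_space.emeasure_space_1)
  qed (auto intro: finite_measure_axioms)
  moreover have "ennreal (\<integral>x. f x \<partial>(?m \<bind> P))
      = ennreal ((\<integral>x. f x \<partial>unregenerated (Suc k)) + regeneration_prob k * (\<integral>x. f x \<partial>\<nu>))"
  proof -
    have "(\<integral>\<^sup>+x. ennreal (f x) \<partial>(?m \<bind> P)) = (\<integral>\<^sup>+x. ennreal (f x) \<partial>unregenerated (Suc k))
        + ennreal (regeneration_prob k) * (\<integral>\<^sup>+x. ennreal (f x) \<partial>\<nu>)"
    proof (rule nn_integral_measure_add)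
      show "emeasure (?m \<bind> P) A = emeasure (unregenerated (Suc k)) A
          + ennreal (regeneration_prob k) * emeasure \<nu> A" if "A \<in> sets (?m \<bind> P)" for A
        using that emeasure_unregenerated_Suc[of A k] sets_step
        unfolding regeneration_prob_ennreal by blast
    qed (use sets sets_nu sets_step B(1) in \<open>auto cong: measurable_cong_sets\<close>)
    then show ?thesis
      using ints beta' by (simp add: ennreal_mult ennreal_plus)
  qed
  moreover have "0 \<le> (\<integral>x. f x \<partial>unregenerated (Suc k)) + regeneration_prob k * (\<integral>x. f x \<partial>\<nu>)"
    using ints beta' by simp
  ultimately show ?thesis by (simp only: ennreal_inj ints)
qed

lemma transition_op_power_nonneg:
  assumes nonneg: "\<And>x. x \<in> space S \<Longrightarrow> 0 \<le> f x" and x: "x \<in> space S"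
  shows "0 \<le> (transition_op P ^^ n) f x"
  using x
proof (induction n arbitrary: x)
  case (Suc n)
  have "0 \<le> (\<integral>y. (transition_op P ^^ n) f y \<partial>P x)"
    by (rule Bochner_Integration.integral_nonneg)
       (use Suc space_eq_of_prob_algebra[OF kernel_space[OF Suc.prems]] in simp)
  then show ?case by (simp add: transition_op_def[of P "(transition_op P ^^ n) f"])
qed (simp add: nonneg)

text \<open>
  Iterating \<open>\<nu> Q\<^sup>k P = \<nu> Q\<^sup>k\<^sup>+\<^sup>1 + \<beta>' (\<nu> Q\<^sup>k)(C) \<nu>\<close> decomposes \<open>\<nu> P\<^sup>n\<close> according to the time
  of the first restart.
\<close>
lemma first_regeneration_decomposition:
  assumes f: "f \<in> bounded_measurable S" and nonneg: "\<And>x. x \<in> space S \<Longrightarrow> 0 \<le> f x"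
  shows "(\<integral>x. (transition_op P ^^ n) f x \<partial>\<nu>) = (\<integral>x. f x \<partial>unregenerated n)
    + (\<Sum>j<n. regeneration_prob j * (\<integral>x. (transition_op P ^^ (n - Suc j)) f x \<partial>\<nu>))"
  using assms
proof (induction n arbitrary: f)
  case (Suc n)
  let ?Pf = "transition_op P f"
  have nonneg': "0 \<le> ?Pf x" if "x \<in> space S" for x
    using transition_op_power_nonneg[of f x 1] Suc.prems that by simp
  have "(\<integral>x. (transition_op P ^^ Suc n) f x \<partial>\<nu>) = (\<integral>x. (transition_op P ^^ n) ?Pf x \<partial>\<nu>)"
    by (simp add: funpow_swap1)
  also have "\<dots> = (\<integral>x. ?Pf x \<partial>unregenerated n)
      + (\<Sum>j<n. regeneration_prob j * (\<integral>x. (transition_op P ^^ (n - Suc j)) ?Pf x \<partial>\<nu>))"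
    by (rule Suc.IH[OF bounded_measurable_transition_op[OF Suc.prems(1)] nonneg'])
  also have "(\<Sum>j<n. regeneration_prob j * (\<integral>x. (transition_op P ^^ (n - Suc j)) ?Pf x \<partial>\<nu>))
      = (\<Sum>j<n. regeneration_prob j * (\<integral>x. (transition_op P ^^ (Suc n - Suc j)) f x \<partial>\<nu>))"
  proof (rule sum.cong[OF refl])
    fix j assume "j \<in> {..<n}"
    then have "Suc n - Suc j = Suc (n - Suc j)" by auto
    then show "regeneration_prob j * (\<integral>x. (transition_op P ^^ (n - Suc j)) ?Pf x \<partial>\<nu>)
      = regeneration_prob j * (\<integral>x. (transition_op P ^^ (Suc n - Suc j)) f x \<partial>\<nu>)"
      by (simp only: funpow_Suc_right o_apply)
  qed
  finally show ?case
    using integral_transition_op_unregenerated[OF Suc.prems, of n] by simp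
qed simp

text \<open>
  For \<open>f = 1\<^sub>C\<close> the first-restart decomposition is a renewal equation for \<open>u\<close>.
\<close>
lemma regeneration_prob_eq_increment:
  assumes ren: "renewal_sequence b u"
    and u: "\<And>n. u (Suc n) = \<beta>' * (\<integral>x. (transition_op P ^^ n) (indicator C) x \<partial>\<nu>)"
  shows "regeneration_prob k = b (Suc k)"
proof (rule renewal_increments_unique[OF ren])
  fix n
  have u0: "u 0 = 1" using ren by (simp add: renewal_sequence_def)
  interpret subprob_space "unregenerated n"
    using unregenerated_subprob[of n] by (simp add: space_subprob_algebra)
  have "C \<in> sets (unregenerated n)"
    using unregenerated_subprob[of n] C by (simp add: space_subprob_algebra)
  then have integral_indicator_measure: "(\<integral>x. indicator C x \<partial>unregenerated n) = measure (unregenerated n) C"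
    by simp
  have "u (Suc n) = regeneration_prob n
      + \<beta>' * (\<Sum>j<n. regeneration_prob j * (\<integral>x. (transition_op P ^^ (n - Suc j)) (indicator C) x \<partial>\<nu>))"
    using u[of n] first_regeneration_decomposition[OF bounded_measurable_indicator[OF C] indicator_pos_le, of n]
    by (simp only: distrib_left integral_indicator_measure)
  also have "\<beta>' * (\<Sum>j<n. regeneration_prob j * (\<integral>x. (transition_op P ^^ (n - Suc j)) (indicator C) x \<partial>\<nu>))
      = (\<Sum>j<n. regeneration_prob j * u (n - j))"
    unfolding sum_distrib_left
  proof (rule sum.cong[OF refl])
    fix j assume "j \<in> {..<n}"
    then have "n - j = Suc (n - Suc j)" by auto
    then show "\<beta>' * (regeneration_prob j * (\<integral>x. (transition_op P ^^ (n - Suc j)) (indicator C) x \<partial>\<nu>))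
        = regeneration_prob j * u (n - j)"
      by (simp only: u mult_ac)
  qed
  also have "regeneration_prob n + (\<Sum>j<n. regeneration_prob j * u (n - j))
      = (\<Sum>j\<le>n. regeneration_prob j * u (n - j))"
    by (simp add: u0 lessThan_Suc_atMost[symmetric])
  finally show "u (Suc n) = (\<Sum>j\<le>n. regeneration_prob j * u (n - j))" .
qed

lemma measure_unregenerated_space:
  assumes "\<And>k. regeneration_prob k = b (Suc k)"
  shows "measure (unregenerated k) (space S) = increment_tail b k"
proof (induction k)
  case 0
  interpret prob_space \<nu> using nu by (simp add: space_prob_algebra)
  show ?case using prob_space space_eq_of_prob_algebra[OF nu] by simp
next
  case (Suc k)
  have "(\<integral>x. transition_op P (\<lambda>_. 1) x \<partial>unregenerated k) = (\<integral>x. 1 \<partial>unregenerated k)"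
  proof (rule Bochner_Integration.integral_cong[OF refl])
    fix x assume "x \<in> space (unregenerated k)"
    then have "x \<in> space S"
      using unregenerated_subprob[of k] sets_eq_imp_space_eq by (auto simp: space_subprob_algebra)
    then interpret prob_space "P x" using kernel_space by (simp add: space_prob_algebra)
    show "transition_op P (\<lambda>_. 1) x = 1" by (simp add: transition_op_def prob_space)
  qed
  moreover interpret prob_space \<nu> using nu by (simp add: space_prob_algebra)
  have "space (unregenerated j) = space S" for j
    using unregenerated_subprob[of j] by (auto simp: space_subprob_algebra dest: sets_eq_imp_space_eq)
  ultimately show ?case
    using integral_transition_op_unregenerated[OF bounded_measurable_const[of 1], of k] Suc assms
    by (simp add: increment_tail_Suc prob_space)
qed

text \<open>
  The occupation measure of one regeneration cycle, \<open>M = \<Sum>k. \<nu> Q\<^sup>k\<close>, satisfies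
  \<open>M P = \<Sum>k. \<nu> Q\<^sup>k\<^sup>+\<^sup>1 + (\<Sum>k. b (k + 1)) \<nu> = M\<close>, and its mass is the mean increment. It
  charges \<open>C\<close> because its first term \<open>\<nu>\<close> does, as \<open>b 1 = \<beta>' \<nu>(C)\<close>. Binding the counting measure
  on \<open>nat\<close> to the family expresses the infinite sum of measures.
\<close>
lemma positive_recurrence:
  assumes b: "increment_sequence b" and ren: "renewal_sequence b u"
    and u: "\<And>n. u (Suc n) = \<beta>' * (\<integral>x. (transition_op P ^^ n) (indicator C) x \<partial>\<nu>)"
    and mean: "summable (increment_tail b)" and b1: "0 < b 1"
  obtains \<mu> where "invariant_prob S P \<mu>" "0 < measure \<mu> C"
proof -
  note reg = regeneration_prob_eq_increment[OF ren u]
  define M where "M = count_space UNIV \<bind> unregenerated"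
  have fam: "unregenerated \<in> count_space UNIV \<rightarrow>\<^sub>M subprob_algebra S"
    using unregenerated_subprob by simp
  have sets_un: "sets (unregenerated k) = sets S" for k
    using unregenerated_subprob[of k] by (simp add: space_subprob_algebra)
  have sets_M: "sets M = sets S" unfolding M_def by (rule sets_bind) (simp_all add: sets_un)
  have space_M: "space M = space S" by (rule sets_eq_imp_space_eq[OF sets_M])
  interpret nu: prob_space \<nu> using nu by (simp add: space_prob_algebra)
  have sets_nu: "sets \<nu> = sets S" using nu by (simp add: space_prob_algebra)
  have space_ne: "space S \<noteq> {}" using nu.not_empty space_eq_of_prob_algebra[OF nu] by simp
  have kernel_M: "P \<in> M \<rightarrow>\<^sub>M subprob_algebra S"
    using kernel_subprob sets_M by (simp cong: measurable_cong_sets)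
  have emeasure_M: "emeasure M A = (\<Sum>k. emeasure (unregenerated k) A)" if "A \<in> sets S" for A
    unfolding M_def using emeasure_bind[OF _ fam that] by (simp add: nn_integral_count_space_nat)
  have M_invariant: "emeasure (M \<bind> P) A = emeasure M A" if A: "A \<in> sets S" for A
  proof -
    have "M \<bind> P = count_space UNIV \<bind> (\<lambda>k. unregenerated k \<bind> P)"
      unfolding M_def by (rule bind_assoc[OF fam kernel_subprob])
    also have "emeasure \<dots> A = (\<Sum>k. emeasure (unregenerated k \<bind> P) A)"
    proof -
      have "(\<lambda>k. unregenerated k \<bind> P) \<in> count_space UNIV \<rightarrow>\<^sub>M subprob_algebra S"
        by (rule measurable_bind2[OF fam kernel_subprob])
      from emeasure_bind[OF _ this A] show ?thesis by (simp add: nn_integral_count_space_nat)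
    qed
    also have "\<dots> = (\<Sum>k. emeasure (unregenerated (Suc k)) A + ennreal (b (Suc k)) * emeasure \<nu> A)"
      unfolding emeasure_unregenerated_Suc[OF A] regeneration_prob_ennreal reg ..
    also have "\<dots> = (\<Sum>k. emeasure (unregenerated (Suc k)) A) + (\<Sum>k. ennreal (b (Suc k))) * emeasure \<nu> A"
      unfolding ennreal_suminf_multc[symmetric]
      by (rule suminf_add[OF summableI summableI, symmetric])
    also have "(\<Sum>k. ennreal (b (Suc k))) = 1"
    proof -
      have "(\<lambda>k. b (Suc k)) sums 1" "\<And>k. 0 \<le> b (Suc k)"
        using b by (simp_all add: increment_sequence_def)
      from suminf_ennreal_eq[OF this(2,1)] show ?thesis by (simp only: ennreal_1)
    qed
    also have "(\<Sum>k. emeasure (unregenerated (Suc k)) A) + 1 * emeasure \<nu> A = emeasure M A"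
      using suminf_offset[of "\<lambda>k. emeasure (unregenerated k) A" 1]
      by (simp add: emeasure_M[OF A])
    finally show ?thesis .
  qed
  define Z where "Z = (\<Sum>k. increment_tail b k)"
  have mass: "emeasure M (space S) = ennreal Z"
  proof -
    have "emeasure (unregenerated k) (space S) = ennreal (increment_tail b k)" for k
    proof -
      interpret subprob_space "unregenerated k"
        using unregenerated_subprob[of k] by (simp add: space_subprob_algebra)
      show ?thesis
        using measure_unregenerated_space[OF reg, of k] by (simp add: emeasure_eq_measure)
    qed
    then show ?thesis
      unfolding Z_def using suminf_ennreal2[OF increment_tail_nonneg[OF b] mean]
      by (simp add: emeasure_M)
  qed
  have "1 \<le> Z"
    unfolding Z_def using sum_le_suminf[OF mean, of "{0}"] increment_tail_nonneg[OF b] by simp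
  define \<mu> where "\<mu> = scale_measure (ennreal (1 / Z)) M"
  have sets_mu: "sets \<mu> = sets S" by (simp add: \<mu>_def sets_M)
  have mu_prob: "prob_space \<mu>"
  proof (rule prob_spaceI)
    show "emeasure \<mu> (space \<mu>) = 1"
      using mass \<open>1 \<le> Z\<close> by (simp add: \<mu>_def space_scale_measure space_M flip: ennreal_mult)
  qed
  have "\<mu> \<bind> P = \<mu>"
  proof (rule measure_eqI)
    have kernel_mu: "P \<in> \<mu> \<rightarrow>\<^sub>M subprob_algebra S"
      using kernel_subprob sets_mu by (simp cong: measurable_cong_sets)
    show "sets (\<mu> \<bind> P) = sets \<mu>"
      using sets_bind'[OF _ kernel, of \<mu>] mu_prob sets_mu by (simp add: space_prob_algebra)
    then have "sets (\<mu> \<bind> P) = sets S" using sets_mu by simp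
    fix A assume "A \<in> sets (\<mu> \<bind> P)"
    then have A: "A \<in> sets S" using \<open>sets (\<mu> \<bind> P) = sets S\<close> by simp
    have "emeasure (\<mu> \<bind> P) A = (\<integral>\<^sup>+x. emeasure (P x) A \<partial>\<mu>)"
      by (rule emeasure_bind[OF _ kernel_mu A]) (use space_ne sets_mu in \<open>auto dest: sets_eq_imp_space_eq\<close>)
    also have "\<dots> = ennreal (1 / Z) * (\<integral>\<^sup>+x. emeasure (P x) A \<partial>M)"
      unfolding \<mu>_def
      by (rule nn_integral_scale_measure)
         (rule measurable_compose[OF kernel_M measurable_emeasure_subprob_algebra[OF A]])
    also have "(\<integral>\<^sup>+x. emeasure (P x) A \<partial>M) = emeasure (M \<bind> P) A"
      by (rule emeasure_bind[OF _ kernel_M A, symmetric]) (use space_ne space_M in simp)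
    also have "ennreal (1 / Z) * emeasure (M \<bind> P) A = emeasure \<mu> A"
      by (simp add: M_invariant[OF A] \<mu>_def)
    finally show "emeasure (\<mu> \<bind> P) A = emeasure \<mu> A" .
  qed
  then have "invariant_prob S P \<mu>"
    using mu_prob sets_mu by (simp add: invariant_prob_def space_prob_algebra)
  moreover have "0 < measure \<mu> C"
  proof -
    interpret mu: prob_space \<mu> by fact
    have "0 < \<beta>' * measure \<nu> C" using reg[of 0] b1 by simp
    then have "0 < measure \<nu> C" using beta' by (rule zero_less_mult_pos)
    then have "0 < emeasure \<nu> C" by (simp add: nu.emeasure_eq_measure)
    also have "\<dots> \<le> emeasure M C"
      using sum_le_suminf[of "\<lambda>k. emeasure (unregenerated k) C" "{0}"] by (simp add: emeasure_M[OF C])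
    finally have "0 < emeasure \<mu> C"
      using \<open>1 \<le> Z\<close> by (simp add: \<mu>_def ennreal_zero_less_mult_iff)
    then show ?thesis by (simp add: mu.emeasure_eq_measure)
  qed
  ultimately show thesis by (rule that)
qed

end

section \<open>Geometric rates for reversible minorized kernels\<close>

text \<open>
  If \<open>\<bar>s n\<bar> / s 0\<close> exceeded \<open>1\<close>, repeated doubling of the index would square it each time and
  contradict boundedness.
\<close>
lemma abs_le_of_doubling:
  fixes s :: "nat \<Rightarrow> real"
  assumes s0: "0 \<le> s 0" and doubling: "\<And>n. (s n)\<^sup>2 \<le> s 0 * s (2 * n)"
    and bounded: "\<And>n. \<bar>s n\<bar> \<le> B"
  shows "\<bar>s n\<bar> \<le> s 0"
proof (rule ccontr)
  assume large: "\<not> \<bar>s n\<bar> \<le> s 0"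
  have "s 0 \<noteq> 0"
  proof
    assume "s 0 = 0"
    then have "(s n)\<^sup>2 \<le> 0" using doubling[of n] by simp
    then have "s n = 0" by simp
    with large s0 show False by simp
  qed
  with s0 have pos: "0 < s 0" by simp
  define y where "y n = \<bar>s n\<bar> / s 0" for n
  have y_square: "(y n)\<^sup>2 \<le> y (2 * n)" for n
  proof -
    have "(y n)\<^sup>2 = (s n)\<^sup>2 / (s 0)\<^sup>2" by (simp add: y_def power_divide)
    also have "\<dots> \<le> (s 0 * s (2 * n)) / (s 0)\<^sup>2"
      using doubling[of n] by (simp add: divide_right_mono)
    also have "\<dots> \<le> y (2 * n)" using pos by (simp add: y_def power2_eq_square divide_right_mono)
    finally show ?thesis .
  qed
  have iterate: "y n ^ (2 ^ k) \<le> y (2 ^ k * n)" for k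
  proof (induction k)
    case (Suc k)
    have "y n ^ (2 ^ Suc k) = (y n ^ (2 ^ k))\<^sup>2" by (simp add: power_mult[symmetric] mult.commute)
    also have "\<dots> \<le> (y (2 ^ k * n))\<^sup>2"
      by (rule power_mono[OF Suc]) (use pos in \<open>simp add: y_def\<close>)
    also have "\<dots> \<le> y (2 ^ Suc k * n)" using y_square[of "2 ^ k * n"] by (simp add: mult_ac)
    finally show ?case .
  qed simp
  have "1 < y n" using large pos by (simp add: y_def)
  then obtain k where k: "B / s 0 < y n ^ k" using real_arch_pow by blast
  have "y n ^ k \<le> y n ^ (2 ^ k)"
    using \<open>1 < y n\<close> by (intro power_increasing) (simp_all add: less_imp_le)
  also have "\<dots> \<le> y (2 ^ k * n)" by (rule iterate)
  also have "\<dots> \<le> B / s 0" using bounded pos by (simp add: y_def divide_right_mono)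
  finally show False using k by simp
qed

text \<open>
  The sequences \<open>s n r\<^sup>n\<close> inherit the doubling inequality, so each is bounded by its own initial
  value \<open>s 0\<close>. This bound is uniform in \<open>r\<close> and survives \<open>r \<rightarrow> R\<close>.
\<close>
lemma geometric_decay_of_doubling:
  fixes s :: "nat \<Rightarrow> real"
  assumes s0: "0 \<le> s 0" and doubling: "\<And>n. (s n)\<^sup>2 \<le> s 0 * s (2 * n)" and R: "0 < R"
    and bounded: "\<And>r. 0 < r \<Longrightarrow> r < R \<Longrightarrow> \<exists>B. \<forall>n. \<bar>s n\<bar> * r ^ n \<le> B"
  shows "\<bar>s n\<bar> * R ^ n \<le> s 0"
proof (rule tendsto_upperbound)
  show "((\<lambda>r. \<bar>s n\<bar> * r ^ n) \<longlongrightarrow> \<bar>s n\<bar> * R ^ n) (at_left R)"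
    by (intro tendsto_intros)
  have "\<bar>s n\<bar> * r ^ n \<le> s 0" if r: "0 < r" "r < R" for r
  proof -
    obtain B where B: "\<And>n. \<bar>s n\<bar> * r ^ n \<le> B" using bounded[OF r] by blast
    have "\<bar>s n * r ^ n\<bar> \<le> s 0 * r ^ 0"
    proof (rule abs_le_of_doubling[of "\<lambda>n. s n * r ^ n"])
      show "(s n * r ^ n)\<^sup>2 \<le> s 0 * r ^ 0 * (s (2 * n) * r ^ (2 * n))" for n
        using mult_right_mono[OF doubling[of n], of "r ^ (2 * n)"] r
        by (simp add: power_mult_distrib power_mult[symmetric] mult.commute[of n 2] mult.assoc)
      show "\<bar>s n * r ^ n\<bar> \<le> B" for n using B[of n] r by (simp add: abs_mult)
    qed (use s0 in simp)
    then show ?thesis using r by (simp add: abs_mult)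
  qed
  then show "\<forall>\<^sub>F r in at_left R. \<bar>s n\<bar> * r ^ n \<le> s 0"
    using eventually_at_left_real[OF R] by (rule eventually_mono[rotated]) auto
qed simp

locale reversible_minorized_kernel =
  reversible_kernel S P \<pi> + minorized_kernel S P C \<nu> \<beta>'
  for S :: "'a measure" and P :: "'a \<Rightarrow> 'a measure" and \<pi> :: "'a measure"
    and C :: "'a set" and \<nu> :: "'a measure" and \<beta>' :: real +
  assumes pi_C: "0 < measure \<pi> C"
begin

text \<open>
  The functional \<open>\<nu>\<close> is bounded on \<open>L\<^sup>2(\<pi>)\<close>, which connects the chain started from \<open>\<nu>\<close> with
  the self-adjoint operator \<open>P\<close>.
\<close>
lemma integral_nu_le:
  assumes "f \<in> bounded_measurable S"
  shows "(\<integral>x. f x \<partial>\<nu>)\<^sup>2 \<le> (1 / (\<beta>' * measure \<pi> C)) * (\<integral>x. (f x)\<^sup>2 \<partial>\<pi>)"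
proof -
  have "(\<integral>x. f x \<partial>\<nu>)\<^sup>2 \<le> (\<integral>x. (f x)\<^sup>2 \<partial>\<nu>)"
    by (rule integral_power2_le[OF nu assms])
  also have "\<dots> \<le> (1 / (\<beta>' * measure \<pi> C)) * (\<integral>x. (f x)\<^sup>2 \<partial>\<pi>)"
    using integral_le_invariant[OF inv bounded_measurable_power2[OF assms]] pi_C beta'
    by (simp add: pos_le_divide_eq mult.commute)
  finally show ?thesis .
qed

text \<open>
  The functional \<open>q \<mapsto> \<integral>q(P) 1\<^sub>C d\<nu>\<close> is dominated by the quadratic form
  \<open>q \<mapsto> \<integral>(q(P) 1\<^sub>C)\<^sup>2 d\<pi>\<close>, whose moment functional is positive on \<open>t q\<^sup>2\<close> and
  \<open>(1 - t) q\<^sup>2\<close>. Its Chebyshev coefficients are therefore bounded.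
\<close>
lemma hitting_series_extends_to_slit_plane:
  assumes pos: "\<And>f. f \<in> bounded_measurable S \<Longrightarrow> 0 \<le> (\<integral>x. f x * transition_op P f x \<partial>\<pi>)"
  defines "a \<equiv> \<lambda>n. \<integral>x. (transition_op P ^^ n) (indicator C) x \<partial>\<nu>"
  obtains G where "G holomorphic_on slit_plane"
    and "\<forall>\<^sub>F z in nhds 0. (\<lambda>n. of_real (a n) * z ^ n) sums G z"
proof -
  let ?m = "autocovariance (indicator C)" and ?K = "1 / (\<beta>' * measure \<pi> C)"
  note bm = bounded_measurable_indicator[OF C]
  have K: "0 \<le> ?K" using pi_C beta' by simp
  interpret nu: prob_space \<nu> using nu by (simp add: space_prob_algebra)
  have a_bound: "\<bar>a n\<bar> \<le> 1" for n
  proof -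
    have "0 \<le> (transition_op P ^^ n) (indicator C) x \<and> (transition_op P ^^ n) (indicator C) x \<le> 1"
      if "x \<in> space S" for x
      using that
    proof (induction n arbitrary: x)
      case (Suc n)
      let ?f = "(transition_op P ^^ n) (indicator C)"
      interpret px: prob_space "P x" using kernel_space[OF Suc.prems] by (simp add: space_prob_algebra)
      have sp: "space (P x) = space S" by (rule space_eq_of_prob_algebra[OF kernel_space[OF Suc.prems]])
      have int: "integrable (P x) ?f"
        by (intro bounded_measurable_integrable[OF kernel_space[OF Suc.prems]]
              bounded_measurable_transition_op_power bm)
      have "(\<integral>y. ?f y \<partial>P x) \<le> (\<integral>y. 1 \<partial>P x)"
        by (rule integral_mono[OF int]) (use Suc.IH sp in auto)
      moreover have "0 \<le> (\<integral>y. ?f y \<partial>P x)"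
        by (rule Bochner_Integration.integral_nonneg) (use Suc.IH sp in auto)
      ultimately show ?case by (simp add: transition_op_def[of P ?f] px.prob_space)
    qed (simp add: indicator_def)
    then have *: "0 \<le> (transition_op P ^^ n) (indicator C) x" "(transition_op P ^^ n) (indicator C) x \<le> 1"
      if "x \<in> space \<nu>" for x
      using that space_eq_of_prob_algebra[OF nu] by simp_all
    have "a n \<le> (\<integral>x. 1 \<partial>\<nu>)"
      unfolding a_def
      by (rule integral_mono[OF bounded_measurable_integrable[OF nu bounded_measurable_transition_op_power[OF bm]]])
         (use * in auto)
    moreover have "0 \<le> a n"
      unfolding a_def by (rule Bochner_Integration.integral_nonneg) (use * in auto)
    ultimately show ?thesis by (simp add: nu.prob_space)
  qed
  have dom: "(moment_functional a q)\<^sup>2 \<le> ?K * moment_functional ?m (q\<^sup>2)" for q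
  proof -
    have "moment_functional a q = (\<integral>x. polynomial_op q (indicator C) x \<partial>\<nu>)"
      using integral_mult_polynomial_op[OF nu bm bounded_measurable_const[of 1], of q] by (simp add: a_def)
    then show ?thesis
      using integral_nu_le[OF bounded_measurable_polynomial_op[OF bm], of q]
        integral_polynomial_op_mult[OF bm, of q q] by (simp add: power2_eq_square)
  qed
  have "(moment_functional a (cheb_T n))\<^sup>2 \<le> ?K * ?m 0" for n
  proof (rule moment_functional_cheb_T_bound[OF _ _ dom K])
    show "0 \<le> moment_functional ?m ([:0, 1:] * q\<^sup>2)" for q
      unfolding moment_functional_autocovariance_shift[OF bm, symmetric]
      by (rule pos[OF bounded_measurable_polynomial_op[OF bm]])
    show "0 \<le> moment_functional ?m ([:1, -1:] * q\<^sup>2)" for q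
      by (rule moment_functional_autocovariance_contraction[OF bm])
  qed
  then have "\<bar>moment_functional a (cheb_T n)\<bar> \<le> sqrt (?K * ?m 0)" for n
    by (rule real_le_rsqrt[of "\<bar>_\<bar>", simplified])
  from holomorphic_extension_slit_plane[of a 1 "sqrt (?K * ?m 0)", OF a_bound this] show thesis
    using that by blast
qed

text \<open>
  Constants are fixed by \<open>P\<close> and \<open>\<pi>\<close> is invariant, so subtracting \<open>\<pi>(C)\<close> from \<open>1\<^sub>C\<close>
  commutes with \<open>P\<^sup>n\<close> and subtracts \<open>\<pi>(C)\<^sup>2\<close> from the autocovariances.
\<close>
lemma autocovariance_centred_indicator:
  defines "f \<equiv> \<lambda>x. indicator C x - measure \<pi> C"
  shows "x \<in> space S \<Longrightarrow> (transition_op P ^^ n) f x = (transition_op P ^^ n) (indicator C) x - measure \<pi> C"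
    and "autocovariance f n = (LINT x:C|\<pi>. (transition_op P ^^ n) (indicator C) x) - (measure \<pi> C)\<^sup>2"
proof -
  let ?c = "measure \<pi> C" and ?I = "\<lambda>n. (transition_op P ^^ n) (indicator C :: _ \<Rightarrow> real)"
  note bm = bounded_measurable_indicator[OF C] bounded_measurable_transition_op_power[OF bounded_measurable_indicator[OF C]]
  interpret pi: prob_space \<pi> using pi_prob by (simp add: space_prob_algebra)
  have sp: "space \<pi> = space S" by (rule space_eq_of_prob_algebra[OF pi_prob])
  have C_pi: "C \<in> sets \<pi>" using C pi_prob by (simp add: space_prob_algebra)
  show power: "(transition_op P ^^ n) f x = ?I n x - ?c" if "x \<in> space S" for x n
    using that
  proof (induction n arbitrary: x)
    case (Suc n)
    interpret px: prob_space "P x" using kernel_space[OF Suc.prems] by (simp add: space_prob_algebra)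
    have "(\<integral>y. (transition_op P ^^ n) f y \<partial>P x) = (\<integral>y. ?I n y - ?c \<partial>P x)"
      by (rule Bochner_Integration.integral_cong)
         (use Suc.IH space_eq_of_prob_algebra[OF kernel_space[OF Suc.prems]] in auto)
    also have "\<dots> = (\<integral>y. ?I n y \<partial>P x) - ?c"
      using bounded_measurable_integrable[OF kernel_space[OF Suc.prems] bm(2)[of n]]
      by (simp add: px.prob_space)
    finally show ?case
      by (simp add: transition_op_def[of P "(transition_op P ^^ n) f"] transition_op_def[of P "?I n"])
  qed (simp add: f_def)
  have mean: "(\<integral>x. ?I n x \<partial>\<pi>) = ?c" for n
  proof (induction n)
    case (Suc n)
    then show ?case using integral_transition_op[OF bm(2)[of n]] by simp
  qed (simp add: C_pi)
  have int: "integrable \<pi> (\<lambda>x. indicator C x * ?I n x)" "integrable \<pi> (?I n)"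
    "integrable \<pi> (indicator C :: _ \<Rightarrow> real)"
    by (intro bounded_measurable_integrable[OF pi_prob] bounded_measurable_intros bm)+
  have "autocovariance f n = (\<integral>x. indicator C x * ?I n x - ?c * indicator C x - ?c * ?I n x + ?c\<^sup>2 \<partial>\<pi>)"
    unfolding autocovariance_def
  proof (rule Bochner_Integration.integral_cong[OF refl])
    fix x assume "x \<in> space \<pi>"
    then have "(transition_op P ^^ n) f x = ?I n x - ?c" using power sp by simp
    moreover have "f x = indicator C x - ?c" by (simp add: f_def)
    ultimately show "f x * (transition_op P ^^ n) f x
        = indicator C x * ?I n x - ?c * indicator C x - ?c * ?I n x + ?c\<^sup>2"
      by (simp only:) (simp add: algebra_simps power2_eq_square)
  qed
  also have "\<dots> = (\<integral>x. indicator C x * ?I n x \<partial>\<pi>) - ?c\<^sup>2"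
    using int C_pi mean[of n] by (simp add: pi.prob_space power2_eq_square)
  finally show "autocovariance f n = (LINT x:C|\<pi>. ?I n x) - ?c\<^sup>2"
    by (simp add: set_lebesgue_integral_def)
qed

text \<open>
  The constant \<open>sqrt \<beta>'\<close> balances two effects of a small set: \<open>\<nu>\<close> has squared norm at most
  \<open>1 / (\<beta>' \<pi>(C))\<close>, while \<open>1\<^sub>C - \<pi>(C)\<close> has squared norm at most \<open>\<pi>(C)\<close>, so \<open>\<pi>(C)\<close> cancels.
\<close>
lemma geometric_rate:
  assumes R: "0 < R"
    and decay: "\<And>r. 0 < r \<Longrightarrow> r < R \<Longrightarrow>
      convergent (\<lambda>n. \<bar>(LINT x:C|\<pi>. (transition_op P ^^ n) (indicator C) x) - (measure \<pi> C)\<^sup>2\<bar> * r ^ n)"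
  shows "\<bar>\<beta>' * (\<integral>x. (transition_op P ^^ n) (indicator C) x \<partial>\<nu>) - \<beta>' * measure \<pi> C\<bar>
    \<le> sqrt \<beta>' * (1 / R) ^ n"
proof -
  define f where "f = (\<lambda>x. indicator C x - measure \<pi> C)"
  let ?c = "measure \<pi> C" and ?s = "autocovariance f"
  note centred = autocovariance_centred_indicator[folded f_def]
  have f: "f \<in> bounded_measurable S"
    unfolding f_def by (intro bounded_measurable_intros bounded_measurable_indicator C)
  note fn = bounded_measurable_transition_op_power[OF f, of n]
  interpret pi: prob_space \<pi> using pi_prob by (simp add: space_prob_algebra)
  interpret nu: prob_space \<nu> using nu by (simp add: space_prob_algebra)
  have C_pi: "C \<in> sets \<pi>" using C pi_prob by (simp add: space_prob_algebra)
  have s0: "0 \<le> ?s 0" using moment_functional_autocovariance_nonneg[OF f, of 1] by simp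
  have bounded: "\<exists>B. \<forall>n. \<bar>?s n\<bar> * r ^ n \<le> B" if "0 < r" "r < R" for r
  proof -
    have "Bseq (\<lambda>n. \<bar>?s n\<bar> * r ^ n)"
      unfolding centred by (rule convergent_imp_Bseq[OF decay[OF that]])
    then obtain B where "\<And>n. norm (\<bar>?s n\<bar> * r ^ n) \<le> B" by (auto simp: Bseq_def)
    then show ?thesis by (auto intro!: exI[of _ B] dest: abs_le_D1)
  qed
  have "?s 0 \<le> ?c"
    using C_pi by (simp add: centred(2) set_lebesgue_integral_def flip: indicator_inter_arith)
  have "((\<integral>x. (transition_op P ^^ n) f x \<partial>\<nu>))\<^sup>2 \<le> (1 / (\<beta>' * ?c)) * ?s (2 * n)"
    using integral_nu_le[OF fn] integral_power_mult_power[OF f, of n n]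
    by (simp add: power2_eq_square mult_2)
  also have "\<dots> \<le> (1 / (\<beta>' * ?c)) * (?c * (1 / R) ^ (2 * n))"
  proof (rule mult_left_mono)
    have "\<bar>?s (2 * n)\<bar> * R ^ (2 * n) \<le> ?s 0"
      by (rule geometric_decay_of_doubling[OF s0 autocovariance_Cauchy_Schwarz[OF f] R bounded])
    moreover have "?s (2 * n) * R ^ (2 * n) \<le> \<bar>?s (2 * n)\<bar> * R ^ (2 * n)"
      by (rule mult_right_mono) (use R in simp_all)
    ultimately have "?s (2 * n) * R ^ (2 * n) \<le> ?c" using \<open>?s 0 \<le> ?c\<close> by linarith
    then show "?s (2 * n) \<le> ?c * (1 / R) ^ (2 * n)"
      using R by (simp add: power_divide pos_le_divide_eq)
  qed (use pi_C beta' in simp)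
  also have "\<dots> = (1 / \<beta>') * ((1 / R) ^ n)\<^sup>2"
    using pi_C by (simp add: power_mult[symmetric] mult.commute)
  finally have "\<beta>'\<^sup>2 * (\<integral>x. (transition_op P ^^ n) f x \<partial>\<nu>)\<^sup>2 \<le> \<beta>'\<^sup>2 * ((1 / \<beta>') * ((1 / R) ^ n)\<^sup>2)"
    by (rule mult_left_mono) simp
  also have "\<dots> = (sqrt \<beta>' * (1 / R) ^ n)\<^sup>2"
    using beta' by (simp add: power_mult_distrib power2_eq_square)
  finally have "(\<beta>' * (\<integral>x. (transition_op P ^^ n) f x \<partial>\<nu>))\<^sup>2 \<le> (sqrt \<beta>' * (1 / R) ^ n)\<^sup>2"
    by (simp only: power_mult_distrib)
  then have "\<bar>\<beta>' * (\<integral>x. (transition_op P ^^ n) f x \<partial>\<nu>)\<bar> \<le> \<bar>sqrt \<beta>' * (1 / R) ^ n\<bar>"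
    by (simp only: abs_le_square_iff)
  moreover have "(\<integral>x. (transition_op P ^^ n) f x \<partial>\<nu>)
      = (\<integral>x. (transition_op P ^^ n) (indicator C) x \<partial>\<nu>) - ?c"
  proof -
    have "(\<integral>x. (transition_op P ^^ n) f x \<partial>\<nu>) = (\<integral>x. (transition_op P ^^ n) (indicator C) x - ?c \<partial>\<nu>)"
      by (rule Bochner_Integration.integral_cong)
         (use centred(1) space_eq_of_prob_algebra[OF nu] in auto)
    then show ?thesis
      using bounded_measurable_integrable[OF nu
          bounded_measurable_transition_op_power[OF bounded_measurable_indicator[OF C]], of n]
      by (simp add: nu.prob_space)
  qed
  ultimately show ?thesis using R beta' by (simp add: right_diff_distrib)
qed

end

theorem corollary3p1:
  fixes S :: "'a measure" and P :: "'a \<Rightarrow> 'a measure" and \<pi> \<nu> :: "'a measure" and C :: "'a set"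
    and \<Omega> :: "'b measure" and X :: "nat \<Rightarrow> 'b \<Rightarrow> 'a"
    and u b :: "nat \<Rightarrow> real" and \<beta>' \<beta> R L :: real
  assumes kernel: "P \<in> S \<rightarrow>\<^sub>M prob_algebra S"
    and inv: "invariant_prob S P \<pi>"
    and unique: "\<And>\<mu>. invariant_prob S P \<mu> \<Longrightarrow> \<mu> = \<pi>"
    and rev: "reversible S P \<pi>"
    and C: "C \<in> sets S" and beta': "\<beta>' > 0" and nu: "\<nu> \<in> space (prob_algebra S)"
    and minor: "\<And>x A. x \<in> space S \<Longrightarrow> A \<in> sets S \<Longrightarrow>
                  measure (P x) A \<ge> \<beta>' * indicator C x * measure \<nu> A"
    and chain: "markov_chain \<Omega> S P \<nu> X"
    and u0: "u 0 = 1"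
    and u: "\<And>n. n \<ge> 1 \<Longrightarrow> u n = \<beta>' * measure \<Omega> {\<omega> \<in> space \<Omega>. X (n - 1) \<omega> \<in> C}"
    and b: "increment_sequence b" and renewal: "renewal_sequence b u"
    and R: "R > 1" and beta: "\<beta> > 0"
    and b_summable: "summable (\<lambda>n. b (Suc n) * R ^ Suc n)"
    and b_le: "(\<Sum>n. b (Suc n) * R ^ Suc n) \<le> L"
    and b1: "b 1 \<ge> \<beta>"
    and pos: "\<And>f. f \<in> borel_measurable \<pi> \<Longrightarrow> integrable \<pi> (\<lambda>x. (f x)\<^sup>2) \<Longrightarrow>
                (\<integral>x. transition_op P f x * f x \<partial>\<pi>) \<ge> 0"
  shows "conv_radius (\<lambda>n. complex_of_real (u n - lim u)) \<ge> ereal R \<and>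
    ((\<forall>r. 0 < r \<and> r < R \<longrightarrow>
        convergent (\<lambda>n. \<bar>(LINT x:C|\<pi>. (transition_op P ^^ n) (indicator C) x)
                          - (measure \<pi> C)\<^sup>2\<bar> * r ^ n)) \<longrightarrow>
     (\<forall>r. 1 < r \<and> r < R \<longrightarrow>
        summable (\<lambda>n. \<bar>u (Suc n) - lim u\<bar> * r ^ Suc n) \<and>
        (\<Sum>n. \<bar>u (Suc n) - lim u\<bar> * r ^ Suc n) \<le> sqrt \<beta>' * r / (1 - r / R)))"
proof -
  interpret markov_kernel S P by unfold_locales (rule kernel)
  interpret minorized_kernel S P C \<nu> \<beta>' by unfold_locales (use C beta' nu minor in auto)
  define a where "a n = (\<integral>x. (transition_op P ^^ n) (indicator C) x \<partial>\<nu>)" for n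
  have u_Suc: "u (Suc n) = \<beta>' * a n" for n
    using u[of "Suc n"] markov_chain_expectation[OF markov_kernel_axioms nu chain C, of n]
    by (simp add: a_def)
  obtain \<mu> where "invariant_prob S P \<mu>" "0 < measure \<mu> C"
    using positive_recurrence[OF b renewal u_Suc[unfolded a_def] increment_tail_summable[OF b R b_summable]]
      b1 beta by auto
  then have "0 < measure \<pi> C" using unique by blast
  then interpret reversible_minorized_kernel S P \<pi> C \<nu> \<beta>'
    using inv rev by unfold_locales
  have pos': "0 \<le> (\<integral>x. f x * transition_op P f x \<partial>\<pi>)" if f: "f \<in> bounded_measurable S" for f
  proof -
    have "sets \<pi> = sets S" using pi_prob by (simp add: space_prob_algebra)
    then have "f \<in> borel_measurable \<pi>"
      using bounded_measurableD[OF f] by (simp cong: measurable_cong_sets)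
    from pos[OF this bounded_measurable_integrable[OF pi_prob bounded_measurable_power2[OF f]]]
    show ?thesis by (simp add: mult.commute)
  qed
  obtain G where G: "G holomorphic_on slit_plane"
    "\<forall>\<^sub>F z in nhds 0. (\<lambda>n. of_real (a n) * z ^ n) sums G z"
    using hitting_series_extends_to_slit_plane[OF pos'] unfolding a_def by blast
  have "ereal R \<le> conv_radius (\<lambda>n. complex_of_real (u n - lim u))"
  proof (rule renewal_conv_radius[OF b renewal R b_summable])
    show "(\<lambda>z. 1 + of_real \<beta>' * z * G z) holomorphic_on slit_plane"
      by (intro holomorphic_intros G(1))
    show "\<forall>\<^sub>F z in nhds 0. (\<lambda>n. of_real (u n) * z ^ n) sums (1 + of_real \<beta>' * z * G z)"
      using G(2)
    proof eventually_elim
      case (elim z)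
      have "(\<lambda>n. of_real (u (Suc n)) * z ^ Suc n) sums (of_real \<beta>' * z * G z)"
        using sums_mult[OF elim, of "of_real \<beta>' * z"] by (simp add: u_Suc mult_ac)
      then show ?case
        using sums_Suc_iff[of "\<lambda>n. of_real (u n) * z ^ n" "of_real \<beta>' * z * G z"]
        by (simp add: u0 add.commute)
    qed
  qed
  moreover have "summable (\<lambda>n. \<bar>u (Suc n) - lim u\<bar> * r ^ Suc n) \<and>
      (\<Sum>n. \<bar>u (Suc n) - lim u\<bar> * r ^ Suc n) \<le> sqrt \<beta>' * r / (1 - r / R)"
    if decay: "\<And>r. 0 < r \<Longrightarrow> r < R \<Longrightarrow>
        convergent (\<lambda>n. \<bar>(LINT x:C|\<pi>. (transition_op P ^^ n) (indicator C) x) - (measure \<pi> C)\<^sup>2\<bar> * r ^ n)"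
      and r: "1 < r" "r < R" for r
  proof -
    have rate: "\<bar>u (Suc n) - \<beta>' * measure \<pi> C\<bar> \<le> sqrt \<beta>' * (1 / R) ^ n" for n
      using geometric_rate[of R n] decay R by (simp add: u_Suc a_def)
    have "(\<lambda>n. u (Suc n) - \<beta>' * measure \<pi> C) \<longlonglongrightarrow> 0"
    proof (rule Lim_null_comparison)
      show "\<forall>\<^sub>F n in sequentially. norm (u (Suc n) - \<beta>' * measure \<pi> C) \<le> sqrt \<beta>' * (1 / R) ^ n"
        using rate by simp
      show "(\<lambda>n. sqrt \<beta>' * (1 / R) ^ n) \<longlonglongrightarrow> 0"
        using R by (intro tendsto_mult_right_zero LIMSEQ_power_zero) simp
    qed
    then have "u \<longlonglongrightarrow> \<beta>' * measure \<pi> C"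
      by (rule LIMSEQ_imp_Suc[OF LIM_zero_cancel])
    then have lim: "lim u = \<beta>' * measure \<pi> C" by (rule limI)
    have geo: "(\<lambda>n. sqrt \<beta>' * r * (r / R) ^ n) sums (sqrt \<beta>' * r * (1 / (1 - r / R)))"
      using r by (intro sums_mult geometric_sums) simp
    have le: "\<bar>u (Suc n) - lim u\<bar> * r ^ Suc n \<le> sqrt \<beta>' * r * (r / R) ^ n" for n
      using mult_right_mono[OF rate[of n], of "r ^ Suc n"] r
      by (simp add: lim power_divide mult_ac)
    have summ: "summable (\<lambda>n. \<bar>u (Suc n) - lim u\<bar> * r ^ Suc n)"
      by (rule summable_comparison_test'[OF sums_summable[OF geo]]) (use le r in \<open>simp add: abs_mult\<close>)
    moreover have "(\<Sum>n. \<bar>u (Suc n) - lim u\<bar> * r ^ Suc n) \<le> sqrt \<beta>' * r / (1 - r / R)"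
      using suminf_le[OF le summ sums_summable[OF geo]] sums_unique[OF geo] by simp
    ultimately show ?thesis by blast
  qed
  ultimately show ?thesis by blast
qed

end
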